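(* Let $X$ be a trawl process with trawl function $a$ and homogeneous Lévy basis $L$ on $\mathbb{R}^2$ with Lévy seed $L'$, observed at times $0,\Delta_n,\ldots,(n-1)\Delta_n$. Assume that, as $n\uparrow\infty$, $\Delta_n\downarrow 0$ and $n\Delta_n\to+\infty$, and suppose that $\mathrm{Var}(L')=1$ and $\mathbb{E}(|L'|^4)<\infty$. Then, for all $t\ge 0$, $\hat a(t)\to a(t)$ in probability as $n\to\infty$.
   Context: A homogeneous Lévy basis $L$ on $\mathbb{R}^2$ with characteristic triplet $(\gamma,b,\nu)$ is a family of real random variables $L(B)$, indexed by Borel sets $B\subset\mathbb{R}^2$ with $\mathrm{Leb}(B)<\infty$, that is almost surely $\sigma$-additive, has $L(B)$ and $L(C)$ independent for disjoint $B,C$ (independently scattered), each $L(B)$ infinitely divisible, and $\log \mathbb{E}(e^{izL(B)})=\mathrm{Leb}(B)\psi(z)$, where $\psi(z)=i\gamma z-\frac12 b^2z^2+\int_{\mathbb{R}\setminus\{0\}}(e^{izx}-1-izx\mathbf 1_{|x|\le1})\nu(\mathrm{d}x)$, with $\gamma\in\mathbb R$, $b\ge 0$ and $\nu$ a Lévy measure. The Lévy seed $L'$ is an infinitely divisible random variable with $\log\mathbb{E}(e^{izL'})=\psi(z)$. A trawl process: let $a:[0,\infty)\to[0,\infty)$ (the trawl function) be continuous, non-increasing and integrable, let $A=\{(r,y): r\le 0,\ 0\le y\le a(-r)\}$ (the trawl set), $A_t=A+(t,0)$, and $X_t=L(A_t)$, $t\in\mathbb{R}$. Estimator: with $\bar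 X_n=\frac1n\sum_{k=1}^{n}X_{(k-1)\Delta_n}$ and $\hat\Gamma_l=\frac1n\sum_{k=0}^{n-1-l}(X_{(l+k)\Delta_n}-\bar X_n)(X_{k\Delta_n}-\bar X_n)$, $l=0,\dots,n-1$, set for $t>0$ $$\hat a(t)=-\Delta_n^{-1}\left[\hat\Gamma_{l+1}-\hat\Gamma_l\right]\quad\text{if } \Delta_n l\le t<(l+1)\Delta_n$$ (well defined for $n$ large), and for $t=0$ $$\hat a(0)=\frac{1}{2\Delta_n n}\sum_{k=0}^{n-2}(\delta_kX)^2,\qquad \delta_kX=X_{(k+1)\Delta_n}-X_{k\Delta_n}.$$ *)

theory Defs
  imports "HOL-Probability.Probability"
begin

section \<open>Infinitely divisible laws and Levy bases\<close>

text \<open>For every \<open>n \<ge> 1\<close>, the law is that of a sum of \<open>n\<close> i.i.d. random variables.\<close>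

definition infinitely_divisible :: "real measure \<Rightarrow> bool" where
  "infinitely_divisible \<mu> \<longleftrightarrow>
     real_distribution \<mu> \<and>
     (\<forall>n\<ge>1. \<exists>\<rho>. real_distribution \<rho> \<and>
        \<mu> = distr (\<Pi>\<^sub>M i\<in>{..<n::nat}. \<rho>) borel (\<lambda>x. \<Sum>i<n. x i))"

definition levy_measure :: "real measure \<Rightarrow> bool" where
  "levy_measure \<nu> \<longleftrightarrow>
     sets \<nu> = sets borel \<and> emeasure \<nu> {0} = 0 \<and>
     (\<integral>\<^sup>+ x. ennreal (min 1 (x\<^sup>2)) \<partial>\<nu>) < \<infinity>"

definition levy_exponent :: "real \<Rightarrow> real \<Rightarrow> real measure \<Rightarrow> real \<Rightarrow> complex" where
  "levy_exponent \<gamma> b \<nu> z =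
     \<i> * \<gamma> * z - (1/2) * b\<^sup>2 * z\<^sup>2
     + (CLINT x:-{0}|\<nu>. iexp (z * x) - 1 - \<i> * z * x * indicator {-1..1} x)"

text \<open>Here and in the locale below, \<open>log E(exp (i z Y)) = c \<psi>(z)\<close> refers to the
  distinguished logarithm (the continuous branch vanishing at \<open>z = 0\<close>). As \<open>\<psi>\<close> is continuous
  with \<open>\<psi>(0) = 0\<close>, this amounts to \<open>E(exp (i z Y)) = exp (c \<psi>(z))\<close>.\<close>

definition levy_seed ::
    "'b measure \<Rightarrow> ('b \<Rightarrow> real) \<Rightarrow> real \<Rightarrow> real \<Rightarrow> real measure \<Rightarrow> bool" where
  "levy_seed N L' \<gamma> b \<nu> \<longleftrightarrow>
     prob_space N \<and> L' \<in> borel_measurable N \<and>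
     infinitely_divisible (distr N borel L') \<and>
     (\<forall>z. char (distr N borel L') z = exp (levy_exponent \<gamma> b \<nu> z))"

definition finite_borel_sets :: "(real \<times> real) set set" where
  "finite_borel_sets = {B \<in> sets borel. emeasure lborel B < \<infinity>}"

locale homogeneous_levy_basis = prob_space M
  for M :: "'a measure"
    and L :: "(real \<times> real) set \<Rightarrow> 'a \<Rightarrow> real"
    and \<gamma> b :: real
    and \<nu> :: "real measure" +
  assumes gaussian_nonneg: "b \<ge> 0"
    and levy_measure: "levy_measure \<nu>"
    and random_variable_L: "\<And>B. B \<in> finite_borel_sets \<Longrightarrow> random_variable borel (L B)"
    and sigma_additive:
      "\<And>B. \<lbrakk>range B \<subseteq> finite_borel_sets; disjoint_family B; (\<Union>i::nat. B i) \<in> finite_borel_sets\<rbrakk>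
        \<Longrightarrow> AE \<omega> in M. (\<lambda>i. L (B i) \<omega>) sums L (\<Union>i. B i) \<omega>"
    and independently_scattered:
      "\<And>B C. \<lbrakk>B \<in> finite_borel_sets; C \<in> finite_borel_sets; B \<inter> C = {}\<rbrakk>
        \<Longrightarrow> indep_var borel (L B) borel (L C)"
    and infinitely_divisible_L:
      "\<And>B. B \<in> finite_borel_sets \<Longrightarrow> infinitely_divisible (distr M borel (L B))"
    and char_L:
      "\<And>B z. B \<in> finite_borel_sets \<Longrightarrow>
        char (distr M borel (L B)) z = exp (measure lborel B * levy_exponent \<gamma> b \<nu> z)"


section \<open>Trawl processes\<close>

text \<open>Trawl functions live on \<open>[0, \<infinity>)\<close>; their values at negative arguments are irrelevant.\<close>

definition trawl_function :: "(real \<Rightarrow> real) \<Rightarrow> bool" where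
  "trawl_function a \<longleftrightarrow>
     (\<forall>s\<ge>0. 0 \<le> a s) \<and> continuous_on {0..} a \<and> antimono_on {0..} a \<and>
     set_integrable lborel {0..} a"

definition trawl_set :: "(real \<Rightarrow> real) \<Rightarrow> (real \<times> real) set" where
  "trawl_set a = {(r, y). r \<le> 0 \<and> 0 \<le> y \<and> y \<le> a (- r)}"

definition trawl_process ::
    "((real \<times> real) set \<Rightarrow> 'a \<Rightarrow> real) \<Rightarrow> (real \<Rightarrow> real) \<Rightarrow> real \<Rightarrow> 'a \<Rightarrow> real" where
  "trawl_process L a t = L ((\<lambda>p. p + (t, 0)) ` trawl_set a)"


section \<open>The estimator\<close>

text \<open>In this section \<open>X\<close> is a sample path, \<open>d\<close> the sampling step and \<open>n\<close> the number of
  observations \<open>X 0, X d, \<dots>, X ((n - 1) d)\<close>.\<close>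

definition sample_mean :: "(real \<Rightarrow> real) \<Rightarrow> real \<Rightarrow> nat \<Rightarrow> real" where
  "sample_mean X d n = (1 / n) * (\<Sum>k=1..n. X ((real k - 1) * d))"

text \<open>The index set \<open>{..<n - l}\<close> is \<open>{0..n - 1 - l}\<close> for \<open>l < n\<close>. Lags \<open>l \<ge> n\<close>, for which the
  statistic is not meaningful, get the value \<open>0\<close>.\<close>

definition sample_autocov :: "(real \<Rightarrow> real) \<Rightarrow> real \<Rightarrow> nat \<Rightarrow> nat \<Rightarrow> real" where
  "sample_autocov X d n l =
     (1 / n) * (\<Sum>k<n - l. (X (real (l + k) * d) - sample_mean X d n)
                         * (X (real k * d) - sample_mean X d n))"

definition lag :: "real \<Rightarrow> real \<Rightarrow> nat" where
  "lag d t = nat \<lfloor>t / d\<rfloor>"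

lemma lag_iff:
  assumes "d > 0" "t \<ge> 0"
  shows "l = lag d t \<longleftrightarrow> d * real l \<le> t \<and> t < (real l + 1) * d"
proof -
  have "l = lag d t \<longleftrightarrow> \<lfloor>t / d\<rfloor> = int l"
    using assms by (auto simp: lag_def)
  also have "\<dots> \<longleftrightarrow> real l \<le> t / d \<and> t / d < real l + 1"
    by (simp add: floor_eq_iff)
  also have "\<dots> \<longleftrightarrow> d * real l \<le> t \<and> t < (real l + 1) * d"
    using assms by (simp add: pos_le_divide_eq pos_divide_less_eq mult.commute)
  finally show ?thesis .
qed

definition trawl_estimator :: "(real \<Rightarrow> real) \<Rightarrow> real \<Rightarrow> nat \<Rightarrow> real \<Rightarrow> real" where
  "trawl_estimator X d n t =
     (if t = 0 then
        1 / (2 * d * n) * (\<Sum>k<n - 1. (X (real (k + 1) * d) - X (real k * d))\<^sup>2)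
      else
        - (1 / d) * (sample_autocov X d n (lag d t + 1) - sample_autocov X d n (lag d t)))"


section \<open>Convergence in probability\<close>

definition converges_in_probability ::
    "'a measure \<Rightarrow> (nat \<Rightarrow> 'a \<Rightarrow> real) \<Rightarrow> real \<Rightarrow> bool" where
  "converges_in_probability M Y c \<longleftrightarrow>
     (\<forall>n. Y n \<in> borel_measurable M) \<and>
     (\<forall>\<epsilon>>0. (\<lambda>n. measure M {\<omega> \<in> space M. \<bar>Y n \<omega> - c\<bar> > \<epsilon>}) \<longlonglongrightarrow> 0)"

end

theory Submission
  imports Defs
begin

text \<open>
  Write \<open>Y B = L B - E (L B)\<close>, \<open>A t\<close> for the trawl set shifted to time \<open>t\<close>, and \<open>d\<close> for the sampling
  step. The estimator is a normalised sum of products \<open>U k * V k\<close> in which each factor is \<open>Y\<close> of a trawl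
  set or a difference of two such terms, plus boundary terms that come from centring with the sample
  mean. The proof is a computation of second moments followed by Markov's inequality.

  \<^emph>\<open>Moments of the basis.\<close> Only pairs of disjoint sets are assumed to give independent variables, but the
  mixed moments of order up to four do not see the difference to joint independence. Indeed
  \<open>(B1, B2, B3, B4) \<mapsto> E (Y B1 * Y B2 * Y B3 * Y B4)\<close> is symmetric and additive in each argument, so by
  polarisation it is determined by its values on tuples that consist of at most two distinct disjoint
  sets (\<open>symmetric_4_additive_eq_0\<close>), and there pairwise independence suffices. As
  \<open>E (Y B ^ 2) = |B|\<close> and \<open>E (Y B ^ 4) = \<kappa> |B| + 3 |B|\<^sup>2\<close> for some \<open>\<kappa> \<ge> 0\<close> (\<open>fourth_cumulant\<close>), this gives
  \<open>\<kappa> |B1 \<inter> B2 \<inter> B3 \<inter> B4|\<close> plus the sum over the three pairings (\<open>fourth_moment_Y\<close>), and by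
  multilinearity the same formula with integrals for differences of such variables.

  \<^emph>\<open>Variance.\<close> If \<open>u k\<close> and \<open>v k\<close> are the integrands of \<open>U k\<close> and \<open>V k\<close>, the covariance of
  \<open>U k * V k\<close> and \<open>U j * V j\<close> is therefore
  \<open>\<kappa> \<integral> u k v k u j v j + (\<integral> u k u j) (\<integral> v k v j) + (\<integral> u k v j) (\<integral> v k u j)\<close>. Here \<open>v k\<close> is the increment
  of the indicators of two consecutive trawl sets. Since the trawl function is monotone, a point lies in
  \<open>A t\<close> exactly for \<open>t\<close> in an interval: it enters once and leaves once, so \<open>\<Sum>k. |v k| \<le> 2\<close> pointwise.
  Moreover \<open>\<integral> |v k| \<le> 2 d a(0)\<close>. Hence the double sum of the covariances over \<open>k, j < n\<close> is of order
  \<open>n d\<close> rather than \<open>n\<^sup>2 d\<close>, and after division by \<open>(n d)\<^sup>2\<close> the variance is of order \<open>1 / (n d)\<close>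
  (\<open>variance_sum_products_le\<close>).

  \<^emph>\<open>Mean.\<close> With \<open>T h\<close> the integral of \<open>a\<close> over \<open>[h, \<infinity>)\<close> we have \<open>|A s \<inter> A t| = T |t - s|\<close>, so the mean
  of the main sum is, up to a factor tending to \<open>1\<close>, the difference quotient \<open>(T (l d) - T (l d + d)) / d\<close>, with \<open>l\<close>
  the lag of \<open>t\<close>.
  By monotonicity it lies between \<open>a (l d + d)\<close> and \<open>a (l d)\<close>, and it tends to \<open>a t\<close> by continuity
  (\<open>tail_area_slope_tendsto\<close>).

  \<^emph>\<open>Boundary.\<close> Summation by parts leaves only boundedly many boundary terms, each bounded in \<open>L\<^sup>1\<close>; they
  vanish after division by \<open>n d\<close>.
\<close>

section \<open>Random variables with finite fourth moment\<close>

definition fourth_power_integrable :: "'a measure \<Rightarrow> ('a \<Rightarrow> real) set" where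
  "fourth_power_integrable M = {f \<in> borel_measurable M. integrable M (\<lambda>x. f x ^ 4)}"

lemma abs_mult4_le: "\<bar>a * b * c * d\<bar> \<le> a ^ 4 + b ^ 4 + c ^ 4 + d ^ 4" for a b c d :: real
proof -
  have amgm: "2 * \<bar>x * y\<bar> \<le> x\<^sup>2 + y\<^sup>2" for x y :: real
    using sum_squares_bound[of "\<bar>x\<bar>" "\<bar>y\<bar>"] by (simp add: abs_mult mult.assoc)
  have prod: "2 * (x * y)\<^sup>2 \<le> x ^ 4 + y ^ 4" for x y :: real
    using amgm[of "x\<^sup>2" "y\<^sup>2"] by (simp add: power_mult_distrib)
  have "0 \<le> a ^ 4" "0 \<le> b ^ 4" "0 \<le> c ^ 4" "0 \<le> d ^ 4" by simp_all
  with amgm[of "a * b" "c * d"] prod[of a b] prod[of c d]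
  have "\<bar>(a * b) * (c * d)\<bar> \<le> a ^ 4 + b ^ 4 + c ^ 4 + d ^ 4" by linarith
  then show ?thesis by (simp add: mult.assoc)
qed

lemma fourth_power_integrable_measurable:
  "f \<in> fourth_power_integrable M \<Longrightarrow> f \<in> borel_measurable M"
  by (simp add: fourth_power_integrable_def)

lemma integrable_mult4:
  assumes "f \<in> fourth_power_integrable M" "g \<in> fourth_power_integrable M"
    "h \<in> fourth_power_integrable M" "k \<in> fourth_power_integrable M"
  shows "integrable M (\<lambda>x. f x * g x * h x * k x)"
proof (rule Bochner_Integration.integrable_bound)
  show "integrable M (\<lambda>x. f x ^ 4 + g x ^ 4 + h x ^ 4 + k x ^ 4)"
    using assms by (auto simp: fourth_power_integrable_def)
  show "(\<lambda>x. f x * g x * h x * k x) \<in> borel_measurable M"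
    using assms[THEN fourth_power_integrable_measurable] by measurable
  show "AE x in M. norm (f x * g x * h x * k x) \<le> norm (f x ^ 4 + g x ^ 4 + h x ^ 4 + k x ^ 4)"
    unfolding real_norm_def by (rule AE_I2) (rule order_trans[OF abs_mult4_le abs_ge_self])
qed

lemma power4_eq: "x ^ 4 = x * x * x * x" for x :: real
  by (simp add: numeral_eq_Suc)

lemma fourth_power_integrable_lincomb:
  assumes "f \<in> fourth_power_integrable M" "g \<in> fourth_power_integrable M"
  shows "(\<lambda>x. c * f x + d * g x) \<in> fourth_power_integrable M"
proof -
  note m = assms[THEN fourth_power_integrable_measurable]
  have *: "(c * u + d * v) ^ 4 = c^4 * (u * u * u * u) + 4 * c^3 * d * (u * u * u * v)
      + 6 * c^2 * d^2 * (u * u * v * v) + 4 * c * d^3 * (u * v * v * v) + d^4 * (v * v * v * v)" for u v :: real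
    by (simp only: power4_eq power3_eq_cube power2_eq_square) (simp add: algebra_simps)
  have "integrable M (\<lambda>x. (c * f x + d * g x) ^ 4)"
    unfolding * by (intro Bochner_Integration.integrable_add integrable_mult_right integrable_mult4 assms)
  then show ?thesis using m by (simp add: fourth_power_integrable_def)
qed

lemma fourth_power_integrable_diff:
  "f \<in> fourth_power_integrable M \<Longrightarrow> g \<in> fourth_power_integrable M
    \<Longrightarrow> (\<lambda>x. f x - g x) \<in> fourth_power_integrable M"
  using fourth_power_integrable_lincomb[of f M g 1 "-1"] by simp

lemma (in finite_measure) fourth_power_integrable_const: "(\<lambda>_. c) \<in> fourth_power_integrable M"
  by (simp add: fourth_power_integrable_def)

lemma (in finite_measure) integrable_of_fourth_power:
  assumes "f \<in> fourth_power_integrable M" shows "integrable M f"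
  using integrable_mult4[OF assms fourth_power_integrable_const[of 1] fourth_power_integrable_const[of 1]
      fourth_power_integrable_const[of 1]] by simp

lemma (in finite_measure) integrable_mult2:
  assumes "f \<in> fourth_power_integrable M" "g \<in> fourth_power_integrable M"
  shows "integrable M (\<lambda>x. f x * g x)"
  using integrable_mult4[OF assms fourth_power_integrable_const[of 1] fourth_power_integrable_const[of 1]] by simp

lemma (in finite_measure) integrable_mult3:
  assumes "f \<in> fourth_power_integrable M" "g \<in> fourth_power_integrable M" "h \<in> fourth_power_integrable M"
  shows "integrable M (\<lambda>x. f x * g x * h x)"
  using integrable_mult4[OF assms fourth_power_integrable_const[of 1]] by simp

text \<open>By Fubini, almost every value \<open>y\<close> of \<open>Y\<close> makes \<open>(X + y) ^ 4\<close> integrable; one such constant is enough.\<close>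

lemma (in prob_space) fourth_power_integrable_indep_summand:
  assumes ind: "indep_var borel X borel Y"
    and sum: "(\<lambda>\<omega>. X \<omega> + Y \<omega>) \<in> fourth_power_integrable M"
  shows "X \<in> fourth_power_integrable M"
proof -
  have X[measurable]: "random_variable borel X" and Y[measurable]: "random_variable borel Y"
    using indep_var_rv1[OF ind] indep_var_rv2[OF ind] by auto
  interpret P: prob_space "distr M borel X" by (rule prob_space_distr) simp
  interpret Q: prob_space "distr M borel Y" by (rule prob_space_distr) simp
  interpret PQ: pair_sigma_finite "distr M borel X" "distr M borel Y" ..
  have joint: "distr M borel X \<Otimes>\<^sub>M distr M borel Y = distr M (borel \<Otimes>\<^sub>M borel) (\<lambda>x. (X x, Y x))"
    using ind by (simp add: indep_var_distribution_eq)
  have "integrable M (\<lambda>\<omega>. (X \<omega> + Y \<omega>) ^ 4)"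
    using sum by (simp add: fourth_power_integrable_def)
  then have "integrable (distr M borel X \<Otimes>\<^sub>M distr M borel Y) (\<lambda>(x, y). (x + y) ^ 4)"
    unfolding joint by (subst integrable_distr_eq) (simp_all add: case_prod_beta)
  then have "AE y in distr M borel Y. integrable (distr M borel X) (\<lambda>x. (x + y) ^ 4)"
    by (rule PQ.AE_integrable_snd)
  then obtain y where "integrable (distr M borel X) (\<lambda>x. (x + y) ^ 4)"
    using Q.AE_contr by (metis (mono_tags, lifting) eventually_mono)
  then have "(\<lambda>x. x + y) \<in> fourth_power_integrable (distr M borel X)"
    by (simp add: fourth_power_integrable_def)
  from fourth_power_integrable_diff[OF this P.fourth_power_integrable_const[of y]]
  have "integrable (distr M borel X) (\<lambda>x. x ^ 4)"
    by (simp add: fourth_power_integrable_def)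
  then show ?thesis
    by (simp add: fourth_power_integrable_def integrable_distr_eq)
qed

section \<open>Additive functions of numbers and of sets\<close>

lemma additive_of_nat_mult:
  fixes g :: "real \<Rightarrow> real"
  assumes add: "\<And>v w. v \<ge> 0 \<Longrightarrow> w \<ge> 0 \<Longrightarrow> g (v + w) = g v + g w" and "w \<ge> 0"
  shows "g (real n * w) = real n * g w"
proof (induction n)
  case 0
  then show ?case using add[of 0 0] by simp
next
  case (Suc n)
  then show ?case using add[of w "real n * w"] \<open>w \<ge> 0\<close> by (simp add: algebra_simps)
qed

text \<open>Cauchy's functional equation: a nonnegative additive function is monotone, so comparing \<open>n * v\<close> with its
  integer part determines \<open>n * g v\<close> up to an error of \<open>g 1\<close>, for every \<open>n\<close>.\<close>

lemma nonneg_additive_imp_linear: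
  fixes g :: "real \<Rightarrow> real"
  assumes add: "\<And>v w. v \<ge> 0 \<Longrightarrow> w \<ge> 0 \<Longrightarrow> g (v + w) = g v + g w"
    and nonneg: "\<And>v. v \<ge> 0 \<Longrightarrow> g v \<ge> 0"
    and "v \<ge> 0"
  shows "g v = v * g 1"
proof -
  have mono: "g v \<le> g w" if "0 \<le> v" "v \<le> w" for v w
    using add[of v "w - v"] nonneg[of "w - v"] that by simp
  have mult: "g (real n * w) = real n * g w" if "w \<ge> 0" for n w
    using add that by (rule additive_of_nat_mult)
  have bound: "real n * \<bar>g v - v * g 1\<bar> \<le> g 1" for n :: nat
  proof -
    define k where "k = nat \<lfloor>real n * v\<rfloor>"
    have k: "real k \<le> real n * v" "real n * v \<le> real k + 1"
      using \<open>v \<ge> 0\<close> unfolding k_def by (auto) 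
    have "real k * g 1 \<le> real n * g v"
      using mono[of "real k" "real n * v"] mult[of 1 k] mult[of v n] k \<open>v \<ge> 0\<close> by simp
    moreover have "real n * g v \<le> (real k + 1) * g 1"
      using mono[of "real n * v" "real (Suc k)"] mult[of 1 "Suc k"] mult[of v n] k \<open>v \<ge> 0\<close>
      by (simp add: add.commute)
    moreover have "real k * g 1 \<le> real n * v * g 1" "real n * v * g 1 \<le> (real k + 1) * g 1"
      using k nonneg[of 1] by (auto intro!: mult_right_mono)
    ultimately have "\<bar>real n * g v - real n * v * g 1\<bar> \<le> g 1"
      by (simp add: algebra_simps abs_le_iff)
    moreover have "real n * \<bar>g v - v * g 1\<bar> = \<bar>real n * g v - real n * v * g 1\<bar>"
      by (simp add: abs_mult mult.assoc flip: right_diff_distrib)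
    ultimately show ?thesis by simp
  qed
  show ?thesis
  proof (rule ccontr)
    assume "g v \<noteq> v * g 1"
    then have "\<bar>g v - v * g 1\<bar> > 0" by simp
    then obtain n where "g 1 < real n * \<bar>g v - v * g 1\<bar>"
      using reals_Archimedean3 by blast
    with bound[of n] show False by simp
  qed
qed

lemma (in ring_of_sets) finite_family_partition:
  assumes "finite F" "F \<subseteq> M"
  shows "\<exists>A. finite A \<and> A \<subseteq> M \<and> disjoint A \<and> (\<forall>B\<in>F. \<exists>A'\<subseteq>A. B = \<Union>A')"
  using assms
proof (induction F)
  case empty
  show ?case by (rule exI[of _ "{}"]) simp
next
  case (insert B F)
  then obtain A where A: "finite A" "A \<subseteq> M" "disjoint A" "\<And>C. C \<in> F \<Longrightarrow> \<exists>A'\<subseteq>A. C = \<Union>A'"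
    by auto
  have B: "B \<in> M" using insert by auto
  \<comment> \<open>Refine the partition \<open>A\<close> by \<open>B\<close> and add the part of \<open>B\<close> that it does not cover.\<close>
  define S where "S = (\<lambda>a. a \<inter> B) ` A \<union> (\<lambda>a. a - B) ` A \<union> {B - \<Union>A}"
  have "finite S" using A by (simp add: S_def)
  moreover have "S \<subseteq> M" unfolding S_def using A(1,2) B by auto
  moreover have "disjoint S"
    using A(3) unfolding S_def disjoint_def by blast
  moreover have "\<exists>S'\<subseteq>S. C = \<Union>S'" if C: "C \<in> insert B F" for C
  proof (cases "C = B")
    case True
    show ?thesis
      by (rule exI[of _ "(\<lambda>a. a \<inter> B) ` A \<union> {B - \<Union>A}"]) (auto simp: S_def True)
  next
    case False
    then obtain A' where A': "A' \<subseteq> A" "C = \<Union>A'" using A(4) C by blast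
    show ?thesis
      by (rule exI[of _ "(\<lambda>a. a \<inter> B) ` A' \<union> (\<lambda>a. a - B) ` A'"]) (use A' in \<open>auto simp: S_def\<close>)
  qed
  ultimately show ?case by blast
qed

lemma (in ring_of_sets) additive_eq_0_if_0_on_partition:
  fixes f :: "'a set \<Rightarrow> real"
  assumes add: "\<And>B C. B \<in> M \<Longrightarrow> C \<in> M \<Longrightarrow> B \<inter> C = {} \<Longrightarrow> f (B \<union> C) = f B + f C"
    and "finite A" "A \<subseteq> M" "disjoint A" "\<And>a. a \<in> A \<Longrightarrow> f a = 0"
  shows "f (\<Union>A) = 0"
  using assms(2-)
proof (induction A)
  case empty
  show ?case using add[of "{}" "{}"] by simp
next
  case (insert a A)
  have "disjoint A" using insert by (auto simp: disjoint_def)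
  moreover have "a \<inter> \<Union>A = {}" using insert(2,5) by (auto simp: disjoint_def)
  moreover have "\<Union>A \<in> M" using insert by (intro finite_Union) auto
  ultimately show ?case using insert add[of a "\<Union>A"] by simp
qed

text \<open>Polarisation: a symmetric 4-additive set function is determined by its values on tuples made of one set,
  or of two disjoint sets with multiplicities \<open>3 + 1\<close> or \<open>2 + 2\<close>. Expanding the pattern \<open>2 + 2\<close> at
  \<open>B \<union> C\<close> gives the pattern \<open>1 + 1 + 2\<close>, and a second expansion gives four distinct disjoint sets. General
  sets are unions of atoms of a common partition.\<close>

lemma (in ring_of_sets) symmetric_4_additive_eq_0:
  fixes D :: "'a set \<Rightarrow> 'a set \<Rightarrow> 'a set \<Rightarrow> 'a set \<Rightarrow> real"
  assumes add: "\<And>B C P Q R. \<lbrakk>B \<in> M; C \<in> M; P \<in> M; Q \<in> M; R \<in> M; B \<inter> C = {}\<rbrakk>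
      \<Longrightarrow> D (B \<union> C) P Q R = D B P Q R + D C P Q R"
    and sym: "\<And>P Q R S. D P Q R S = D Q P R S" "\<And>P Q R S. D P Q R S = D P R Q S"
      "\<And>P Q R S. D P Q R S = D P Q S R"
    and D4: "\<And>B. B \<in> M \<Longrightarrow> D B B B B = 0"
    and D31: "\<And>B C. B \<in> M \<Longrightarrow> C \<in> M \<Longrightarrow> B \<inter> C = {} \<Longrightarrow> D B B B C = 0"
    and D22: "\<And>B C. B \<in> M \<Longrightarrow> C \<in> M \<Longrightarrow> B \<inter> C = {} \<Longrightarrow> D B B C C = 0"
    and in_M: "P \<in> M" "Q \<in> M" "R \<in> M" "S \<in> M"
  shows "D P Q R S = 0"
proof -
  have D211: "D B C E E = 0" if "B \<in> M" "C \<in> M" "E \<in> M" "B \<inter> C = {}" "B \<inter> E = {}" "C \<inter> E = {}" for B C E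
  proof -
    have "0 = D (B \<union> C) (B \<union> C) E E" by (rule D22[symmetric]) (use that in auto)
    also have "\<dots> = D (B \<union> C) B E E + D (B \<union> C) C E E"
      using add[of B C "B \<union> C" E E] Un[of B C] that by (simp add: sym)
    also have "\<dots> = D B B E E + D C B E E + D B C E E + D C C E E"
      using add[of B C B E E] add[of B C C E E] that by simp
    also have "\<dots> = 2 * D B C E E" using D22 that sym(1)[of C B] by simp
    finally show ?thesis by simp
  qed
  have D1111: "D B C E F = 0"
    if "B \<in> M" "C \<in> M" "E \<in> M" "F \<in> M" "B \<inter> C = {}" "B \<inter> E = {}" "C \<inter> E = {}"
      "B \<inter> F = {}" "C \<inter> F = {}" "E \<inter> F = {}" for B C E F
  proof -
    have add3: "D P Q (E \<union> F) R = D P Q E R + D P Q F R" if "P \<in> M" "Q \<in> M" "R \<in> M" for P Q R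
      using add[of E F P Q R] that \<open>E \<in> M\<close> \<open>F \<in> M\<close> \<open>E \<inter> F = {}\<close> sym by metis
    have "0 = D B C (E \<union> F) (E \<union> F)"
      by (rule D211[symmetric]) (use that in auto)
    also have "\<dots> = D B C E (E \<union> F) + D B C F (E \<union> F)"
      using that by (intro add3) auto
    also have "\<dots> = D B C (E \<union> F) E + D B C (E \<union> F) F" using sym by metis
    also have "\<dots> = D B C E E + D B C F E + D B C E F + D B C F F"
      using that by (simp add: add3)
    also have "\<dots> = 2 * D B C E F"
      using D211[of B C E] D211[of B C F] that sym(3)[of B C F E] by simp
    finally show ?thesis by simp
  qed
  obtain A where A: "finite A" "A \<subseteq> M" "disjoint A" "\<forall>B\<in>{P, Q, R, S}. \<exists>A'\<subseteq>A. B = \<Union>A'"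
    using finite_family_partition[of "{P, Q, R, S}"] in_M by auto
  have disj: "x \<inter> y = {}" if "x \<in> A" "y \<in> A" "x \<noteq> y" for x y
    using A(3) that by (auto simp: disjoint_def)
  have pair: "D x x y z = 0" if xyz: "x \<in> A" "y \<in> A" "z \<in> A" for x y z
  proof -
    have M: "x \<in> M" "y \<in> M" "z \<in> M" using xyz A by auto
    consider "x = y" "x = z" | "x = y" "x \<noteq> z" | "x \<noteq> y" "x = z" | "x \<noteq> y" "y = z" | "x \<noteq> y" "x \<noteq> z" "y \<noteq> z"
      by blast
    then show ?thesis
    proof cases
      case 1 then show ?thesis using D4 M by simp
    next
      case 2 then show ?thesis using D31[of x z] M xyz disj by simp
    next
      case 3 then show ?thesis using D31[of x y] M xyz disj sym(3)[of x x y x] by simp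
    next
      case 4 then show ?thesis using D22[of x y] M xyz disj by simp
    next
      case 5
      have "D x x y z = D y z x x" by (simp add: sym)
      then show ?thesis using 5 D211[of y z x] M xyz disj by simp
    qed
  qed
  have on_A: "D p q r s = 0" if pqrs: "p \<in> A" "q \<in> A" "r \<in> A" "s \<in> A" for p q r s
  proof -
    have M: "p \<in> M" "q \<in> M" "r \<in> M" "s \<in> M" using pqrs A by auto
    have perm: "D p q r s = D p r q s" "D p q r s = D p s q r" "D p q r s = D q r p s"
      "D p q r s = D q s p r" "D p q r s = D r s p q"
      by (simp_all add: sym)
    consider "p = q" | "p = r" | "p = s" | "q = r" | "q = s" | "r = s"
      | "p \<noteq> q" "p \<noteq> r" "p \<noteq> s" "q \<noteq> r" "q \<noteq> s" "r \<noteq> s"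
      by blast
    then show ?thesis
    proof cases
      case 1 then show ?thesis using pair pqrs by simp
    next
      case 2 then show ?thesis using pair pqrs perm(1) by simp
    next
      case 3 then show ?thesis using pair pqrs perm(2) by simp
    next
      case 4 then show ?thesis using pair pqrs perm(3) by simp
    next
      case 5 then show ?thesis using pair pqrs perm(4) by simp
    next
      case 6 then show ?thesis using pair pqrs perm(5) by simp
    next
      case 7 then show ?thesis using D1111[of p q r s] M pqrs disj by simp
    qed
  qed
  \<comment> \<open>Pass from atoms to arbitrary sets, one argument of \<open>D\<close> at a time.\<close>
  have on_union: "f B = 0" if B: "B \<in> {P, Q, R, S}"
    and f_add: "\<And>B C. B \<in> M \<Longrightarrow> C \<in> M \<Longrightarrow> B \<inter> C = {} \<Longrightarrow> f (B \<union> C) = f B + f C"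
    and f_A: "\<And>a. a \<in> A \<Longrightarrow> f a = 0" for f :: "'a set \<Rightarrow> real" and B
  proof -
    from bspec[OF A(4) B] obtain A' where A': "A' \<subseteq> A" "B = \<Union>A'" by (elim exE conjE)
    have "finite A'" "A' \<subseteq> M" "disjoint A'"
      using A A' by (auto intro: finite_subset simp: disjoint_def)
    then have "f (\<Union>A') = 0"
      using f_add f_A A'(1) by (rule_tac additive_eq_0_if_0_on_partition[of f A']) auto
    then show ?thesis using A' by simp
  qed
  have A_M: "a \<in> M" if "a \<in> A" for a using that A(2) by auto
  have 1: "D P q r s = 0" if qrs: "q \<in> A" "r \<in> A" "s \<in> A" for q r s
    by (rule on_union[of P "\<lambda>B. D B q r s"])
       (simp, rule add, use qrs A_M on_A in simp_all)
  have 2: "D P Q r s = 0" if rs: "r \<in> A" "s \<in> A" for r s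
  proof -
    have swap: "D x P r s = D P x r s" for x by (rule sym)
    have "D Q P r s = 0"
      by (rule on_union[of Q "\<lambda>B. D B P r s"])
         (simp, rule add, use rs A_M 1 in_M in \<open>simp_all add: swap\<close>)
    then show ?thesis by (simp only: swap)
  qed
  have 3: "D P Q R s = 0" if s: "s \<in> A" for s
  proof -
    have cyc: "D x P Q s = D P Q x s" for x by (simp add: sym)
    have "D R P Q s = 0"
      by (rule on_union[of R "\<lambda>B. D B P Q s"])
         (simp, rule add, use s A_M 2 in_M in \<open>simp_all add: cyc\<close>)
    then show ?thesis by (simp only: cyc)
  qed
  have cyc: "D x P Q R = D P Q R x" for x by (simp add: sym)
  have "D S P Q R = 0"
    by (rule on_union[of S "\<lambda>B. D B P Q R"])
       (simp, rule add, use A_M 3 in_M in \<open>simp_all add: cyc\<close>)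
  then show ?thesis by (simp only: cyc)
qed

section \<open>Moments of a standardised Levy basis\<close>

lemma finite_borel_sets_iff: "B \<in> finite_borel_sets \<longleftrightarrow> B \<in> fmeasurable lborel"
  by (simp add: finite_borel_sets_def fmeasurable_def)

interpretation finite_borel: ring_of_sets UNIV finite_borel_sets
  by (rule ring_of_setsI) (auto simp: finite_borel_sets_iff)

lemmas [simp] = finite_borel.Un finite_borel.Int finite_borel.Diff

lemma measure_finite_borel_Un:
  "B \<in> finite_borel_sets \<Longrightarrow> C \<in> finite_borel_sets \<Longrightarrow> B \<inter> C = {}
    \<Longrightarrow> measure lborel (B \<union> C) = measure lborel B + measure lborel C"
  by (intro measure_Union) (auto simp: finite_borel_sets_def)

text \<open>The law of \<open>L B\<close> depends on the area of \<open>B\<close> only, so moments can be computed on boxes. Adjacent boxes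
  provide disjoint sets of prescribed areas whose union is again a box.\<close>

definition box_of_measure :: "real \<Rightarrow> real \<Rightarrow> (real \<times> real) set" where
  "box_of_measure x v = {x..<x + v} \<times> {0..<1}"

lemma
  assumes "v \<ge> 0"
  shows box_of_measure: "box_of_measure x v \<in> finite_borel_sets"
    and measure_box_of_measure: "measure lborel (box_of_measure x v) = v"
proof -
  have "emeasure lborel (box_of_measure x v) = ennreal v"
    unfolding box_of_measure_def lborel_prod[symmetric] using assms
    by (subst lborel.emeasure_pair_measure_Times) simp_all
  moreover have "box_of_measure x v \<in> sets borel"
    unfolding box_of_measure_def borel_prod[symmetric] by measurable
  ultimately show "box_of_measure x v \<in> finite_borel_sets" "measure lborel (box_of_measure x v) = v"
    using assms by (auto simp: finite_borel_sets_def measure_def)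
qed

lemma box_of_measure_Un:
  "0 \<le> v \<Longrightarrow> 0 \<le> w \<Longrightarrow> box_of_measure x (v + w) = box_of_measure x v \<union> box_of_measure (x + v) w"
  by (auto simp: box_of_measure_def)

lemma box_of_measure_disjoint: "box_of_measure x v \<inter> box_of_measure (x + v) w = {}"
  by (auto simp: box_of_measure_def)

context homogeneous_levy_basis
begin

text \<open>The empty set is the disjoint union of countably many copies of itself, and a constant series converges
  only if its terms vanish.\<close>

lemma L_empty: "AE \<omega> in M. L {} \<omega> = 0"
proof -
  have "{} \<in> finite_borel_sets" by simp
  then have "AE \<omega> in M. (\<lambda>i::nat. L {} \<omega>) sums L {} \<omega>"
    using sigma_additive[of "\<lambda>_. {}"] by (simp add: disjoint_family_on_def)
  then show ?thesis
    by eventually_elim (auto dest!: sums_summable simp: summable_const_iff)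
qed

lemma L_Un:
  assumes "B \<in> finite_borel_sets" "C \<in> finite_borel_sets" "B \<inter> C = {}"
  shows "AE \<omega> in M. L (B \<union> C) \<omega> = L B \<omega> + L C \<omega>"
proof -
  define S where "S = (\<lambda>i::nat. if i = 0 then B else if i = 1 then C else {})"
  have U: "(\<Union>i. S i) = B \<union> C"
  proof (intro set_eqI iffI)
    fix x assume "x \<in> B \<union> C"
    then have "x \<in> S 0 \<or> x \<in> S 1" by (auto simp: S_def)
    then show "x \<in> (\<Union>i. S i)" by blast
  qed (auto simp: S_def split: if_splits)
  have "AE \<omega> in M. (\<lambda>i. L (S i) \<omega>) sums L (\<Union>i. S i) \<omega>"
    unfolding U using assms U
    by (intro sigma_additive[of S, unfolded U]) (auto simp: S_def disjoint_family_on_def)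
  with L_empty show ?thesis
  proof eventually_elim
    case (elim \<omega>)
    have "(\<lambda>i. L (S i) \<omega>) sums (\<Sum>i\<in>{0,1}. L (S i) \<omega>)"
      by (rule sums_finite) (auto simp: S_def elim)
    with elim(2) have "L (\<Union>i. S i) \<omega> = (\<Sum>i\<in>{0,1}. L (S i) \<omega>)"
      by (rule sums_unique2)
    then show ?case by (simp add: U) (simp add: S_def)
  qed
qed

lemma law_L_eq:
  assumes "B \<in> finite_borel_sets" "C \<in> finite_borel_sets" "measure lborel B = measure lborel C"
  shows "distr M borel (L B) = distr M borel (L C)"
  using assms char_L random_variable_L
  by (intro Levy_uniqueness ext) (auto intro!: real_distribution_distr)

end

text \<open>A Levy basis whose seed has variance \<open>1\<close> and a finite fourth moment.\<close>

locale standardized_levy_basis = homogeneous_levy_basis M L \<gamma> b \<nu>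
  for M :: "'a measure" and L :: "(real \<times> real) set \<Rightarrow> 'a \<Rightarrow> real" and \<gamma> b :: real and \<nu> :: "real measure" +
  fixes N :: "'b measure" and L' :: "'b \<Rightarrow> real"
  assumes seed: "levy_seed N L' \<gamma> b \<nu>"
    and variance_seed: "prob_space.variance N L' = 1"
    and fourth_moment_seed: "integrable N (\<lambda>\<omega>. \<bar>L' \<omega>\<bar> ^ 4)"
begin

lemma law_L_seed:
  assumes "B \<in> finite_borel_sets" "measure lborel B = 1"
  shows "distr M borel (L B) = distr N borel L'"
proof -
  interpret N: prob_space N using seed by (simp add: levy_seed_def)
  show ?thesis
    using assms char_L random_variable_L seed
    by (intro Levy_uniqueness ext N.real_distribution_distr real_distribution_distr)
       (auto simp: levy_seed_def)
qed

lemma L_fourth_power_integrable_cong: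
  assumes "B \<in> finite_borel_sets" "C \<in> finite_borel_sets" "measure lborel B = measure lborel C"
    "L B \<in> fourth_power_integrable M"
  shows "L C \<in> fourth_power_integrable M"
proof -
  note [measurable] = random_variable_L[OF assms(1)] random_variable_L[OF assms(2)]
  have "integrable (distr M borel (L B)) (\<lambda>x. x ^ 4)"
    using assms(4) by (simp add: integrable_distr_eq fourth_power_integrable_def)
  then have "integrable (distr M borel (L C)) (\<lambda>x. x ^ 4)"
    using law_L_eq[OF assms(1-3)] by simp
  then show ?thesis by (simp add: integrable_distr_eq fourth_power_integrable_def)
qed

lemma fourth_power_integrable_AE_cong:
  assumes "f \<in> fourth_power_integrable M" "g \<in> borel_measurable M" "AE \<omega> in M. f \<omega> = g \<omega>"
  shows "g \<in> fourth_power_integrable M"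
proof -
  have "integrable M (\<lambda>\<omega>. g \<omega> ^ 4) \<longleftrightarrow> integrable M (\<lambda>\<omega>. f \<omega> ^ 4)"
    using assms by (intro integrable_cong_AE) (auto simp: fourth_power_integrable_def)
  then show ?thesis using assms by (simp add: fourth_power_integrable_def)
qed

text \<open>A set of area \<open>1\<close> has the law of the seed; adding disjoint unit boxes gives all integer areas; and a box of
  any area is an independent summand of a larger box of integer area.\<close>

lemma L_fourth_power_integrable:
  assumes B: "B \<in> finite_borel_sets"
  shows "L B \<in> fourth_power_integrable M"
proof -
  have unit: "L C \<in> fourth_power_integrable M" if C: "C \<in> finite_borel_sets" "measure lborel C = 1" for C
  proof -
    note [measurable] = random_variable_L[OF C(1)]
    have [measurable]: "L' \<in> borel_measurable N" using seed by (simp add: levy_seed_def)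
    have "integrable (distr N borel L') (\<lambda>x. x ^ 4)"
      using fourth_moment_seed by (simp add: integrable_distr_eq)
    then have "integrable (distr M borel (L C)) (\<lambda>x. x ^ 4)"
      using law_L_seed[OF C] by simp
    then show ?thesis by (simp add: integrable_distr_eq fourth_power_integrable_def)
  qed
  have nat: "L (box_of_measure 0 (real n)) \<in> fourth_power_integrable M" for n
  proof (induction n)
    case 0
    have "box_of_measure 0 (real 0) = {}" by (simp add: box_of_measure_def)
    with L_empty show ?case
      by (intro fourth_power_integrable_AE_cong[OF fourth_power_integrable_const[of 0]])
         (auto intro: random_variable_L)
  next
    case (Suc n)
    have eq: "box_of_measure 0 (real (Suc n)) = box_of_measure 0 (real n) \<union> box_of_measure (real n) 1"
      using box_of_measure_Un[of "real n" 1 0] by (simp add: add.commute)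
    have "L (box_of_measure (real n) 1) \<in> fourth_power_integrable M"
      by (intro unit box_of_measure measure_box_of_measure) simp_all
    with Suc have "(\<lambda>\<omega>. L (box_of_measure 0 (real n)) \<omega> + L (box_of_measure (real n) 1) \<omega>) \<in> fourth_power_integrable M"
      using fourth_power_integrable_lincomb[of _ M _ 1 1] by simp
    moreover have "AE \<omega> in M. L (box_of_measure 0 (real n)) \<omega> + L (box_of_measure (real n) 1) \<omega>
        = L (box_of_measure 0 (real (Suc n))) \<omega>"
      unfolding eq using box_of_measure_disjoint[of 0 "real n" 1] by (intro AE_symmetric[OF L_Un] box_of_measure) auto
    ultimately show ?case
      by (rule fourth_power_integrable_AE_cong[OF _ random_variable_L[OF box_of_measure[OF of_nat_0_le_iff]]])
  qed
  define v where "v = measure lborel B"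
  obtain n :: nat where n: "v \<le> real n" using real_arch_simple by blast
  have v: "v \<ge> 0" by (simp add: v_def)
  define C where "C = box_of_measure 0 v"
  define E where "E = box_of_measure v (real n - v)"
  have CE: "C \<in> finite_borel_sets" "E \<in> finite_borel_sets" "C \<inter> E = {}"
    using v n box_of_measure_disjoint[of 0 v "real n - v"] by (auto simp: C_def E_def intro!: box_of_measure)
  have U: "C \<union> E = box_of_measure 0 (real n)"
    using box_of_measure_Un[of v "real n - v" 0] v n by (simp add: C_def E_def)
  have "(\<lambda>\<omega>. L C \<omega> + L E \<omega>) \<in> fourth_power_integrable M"
    using nat[of n] L_Un[OF CE] CE random_variable_L unfolding U
    by (intro fourth_power_integrable_AE_cong[OF nat[of n]]) auto
  with independently_scattered[OF CE] have "L C \<in> fourth_power_integrable M"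
    by (rule fourth_power_integrable_indep_summand)
  then show ?thesis
    by (rule L_fourth_power_integrable_cong[rotated 3])
       (use B CE v in \<open>auto simp: C_def measure_box_of_measure v_def\<close>)
qed

definition Y :: "(real \<times> real) set \<Rightarrow> 'a \<Rightarrow> real" where
  "Y B \<omega> = L B \<omega> - expectation (L B)"

lemma Y_fourth_power_integrable [simp]:
  "B \<in> finite_borel_sets \<Longrightarrow> Y B \<in> fourth_power_integrable M"
  unfolding Y_def by (intro fourth_power_integrable_diff fourth_power_integrable_const L_fourth_power_integrable)

lemma Y_measurable: "B \<in> finite_borel_sets \<Longrightarrow> Y B \<in> borel_measurable M"
  by (intro fourth_power_integrable_measurable Y_fourth_power_integrable)

lemma expectation_L_eq:
  assumes "B \<in> finite_borel_sets" "C \<in> finite_borel_sets" "measure lborel B = measure lborel C"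
    and [measurable]: "f \<in> borel_measurable borel"
  shows "expectation (\<lambda>\<omega>. f (L B \<omega>)) = expectation (\<lambda>\<omega>. f (L C \<omega>) :: real)"
  using law_L_eq[OF assms(1-3)] random_variable_L assms
  by (metis integral_distr[of "L B" M borel f] integral_distr[of "L C" M borel f])

lemma moment_Y_eq:
  assumes "B \<in> finite_borel_sets" "C \<in> finite_borel_sets" "measure lborel B = measure lborel C"
  shows "expectation (\<lambda>\<omega>. Y B \<omega> ^ p) = expectation (\<lambda>\<omega>. Y C \<omega> ^ p)"
  using expectation_L_eq[OF assms, of "\<lambda>x. x"]
  unfolding Y_def by (subst expectation_L_eq[OF assms, of "\<lambda>x. (x - _) ^ p"]) auto

lemma expectation_Y: "B \<in> finite_borel_sets \<Longrightarrow> expectation (Y B) = 0"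
  unfolding Y_def
  using integrable_of_fourth_power[OF L_fourth_power_integrable] by (simp add: prob_space)

lemma Y_Un:
  assumes "B \<in> finite_borel_sets" "C \<in> finite_borel_sets" "B \<inter> C = {}"
  shows "AE \<omega> in M. Y (B \<union> C) \<omega> = Y B \<omega> + Y C \<omega>"
proof -
  have "expectation (L (B \<union> C)) = expectation (\<lambda>\<omega>. L B \<omega> + L C \<omega>)"
    using assms L_Un random_variable_L by (intro integral_cong_AE) auto
  also have "\<dots> = expectation (L B) + expectation (L C)"
    using assms by (intro Bochner_Integration.integral_add integrable_of_fourth_power L_fourth_power_integrable)
  finally have e: "expectation (L (B \<union> C)) = expectation (L B) + expectation (L C)" .
  show ?thesis using L_Un[OF assms] by eventually_elim (simp add: Y_def e)
qed

lemma expectation_Y_disjoint: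
  assumes "B \<in> finite_borel_sets" "C \<in> finite_borel_sets" "B \<inter> C = {}"
    and "p \<le> 4" "q \<le> 4"
  shows "expectation (\<lambda>\<omega>. Y B \<omega> ^ p * Y C \<omega> ^ q) = expectation (\<lambda>\<omega>. Y B \<omega> ^ p) * expectation (\<lambda>\<omega>. Y C \<omega> ^ q)"
proof (rule indep_var_lebesgue_integral)
  have "indep_var borel ((\<lambda>x. (x - expectation (L B)) ^ p) \<circ> L B) borel ((\<lambda>x. (x - expectation (L C)) ^ q) \<circ> L C)"
    using independently_scattered[OF assms(1-3)] by (rule indep_var_compose) auto
  then show "indep_var borel (\<lambda>\<omega>. Y B \<omega> ^ p) borel (\<lambda>\<omega>. Y C \<omega> ^ q)"
    by (simp add: comp_def Y_def)
  have "integrable M (\<lambda>\<omega>. Y E \<omega> ^ r)" if "E \<in> finite_borel_sets" "r \<le> 4" for E r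
  proof -
    note i = Y_fourth_power_integrable[OF that(1)]
    have "r \<in> {0, 1, 2, 3, 4}" using that(2) by auto
    then show ?thesis
      using integrable_of_fourth_power[OF i] integrable_mult2[OF i i] integrable_mult3[OF i i i]
        integrable_mult4[OF i i i i] by (auto simp: numeral_eq_Suc mult.assoc)
  qed
  then show "integrable M (\<lambda>\<omega>. Y B \<omega> ^ p)" "integrable M (\<lambda>\<omega>. Y C \<omega> ^ q)"
    using assms by auto
qed

lemma expectation_Y_square_Un:
  assumes "B \<in> finite_borel_sets" "C \<in> finite_borel_sets" "B \<inter> C = {}"
  shows "expectation (\<lambda>\<omega>. Y (B \<union> C) \<omega> ^ 2) = expectation (\<lambda>\<omega>. Y B \<omega> ^ 2) + expectation (\<lambda>\<omega>. Y C \<omega> ^ 2)"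
proof -
  note i = Y_fourth_power_integrable[OF assms(1)] Y_fourth_power_integrable[OF assms(2)]
  have "expectation (\<lambda>\<omega>. Y (B \<union> C) \<omega> ^ 2) = expectation (\<lambda>\<omega>. (Y B \<omega> + Y C \<omega>) ^ 2)"
    using assms Y_Un[OF assms] Y_measurable by (intro integral_cong_AE) auto
  also have "\<dots> = expectation (\<lambda>\<omega>. Y B \<omega> * Y B \<omega> + 2 * (Y B \<omega> * Y C \<omega>) + Y C \<omega> * Y C \<omega>)"
    by (simp add: power2_eq_square algebra_simps)
  also have "\<dots> = expectation (\<lambda>\<omega>. Y B \<omega> ^ 2) + 2 * expectation (\<lambda>\<omega>. Y B \<omega> * Y C \<omega>) + expectation (\<lambda>\<omega>. Y C \<omega> ^ 2)"
    using integrable_mult2[OF i(1) i(1)] integrable_mult2[OF i(1) i(2)] integrable_mult2[OF i(2) i(2)]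
    by (simp add: power2_eq_square)
  finally show ?thesis
    using expectation_Y_disjoint[OF assms, of 1 1] expectation_Y assms by simp
qed

text \<open>The variance is nonnegative and additive over disjoint sets, hence a linear function of the area, and it is
  \<open>1\<close> at unit area.\<close>

lemma expectation_Y_square:
  assumes B: "B \<in> finite_borel_sets"
  shows "expectation (\<lambda>\<omega>. Y B \<omega> ^ 2) = measure lborel B"
proof -
  define g where "g v = expectation (\<lambda>\<omega>. Y (box_of_measure 0 v) \<omega> ^ 2)" for v
  have g: "expectation (\<lambda>\<omega>. Y C \<omega> ^ 2) = g (measure lborel C)" if "C \<in> finite_borel_sets" for C
    unfolding g_def using that by (intro moment_Y_eq) (auto simp: box_of_measure measure_box_of_measure)
  have "g (measure lborel B) = measure lborel B * g 1"
  proof (rule nonneg_additive_imp_linear)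
    fix v w :: real assume vw: "v \<ge> 0" "w \<ge> 0"
    have "box_of_measure 0 v \<inter> box_of_measure v w = {}" using box_of_measure_disjoint[of 0 v w] by simp
    moreover have "box_of_measure 0 (v + w) = box_of_measure 0 v \<union> box_of_measure v w"
      using box_of_measure_Un[of v w 0] vw by simp
    ultimately show "g (v + w) = g v + g w"
      using expectation_Y_square_Un[of "box_of_measure 0 v" "box_of_measure v w"] vw
        g[of "box_of_measure v w"]
      by (simp add: box_of_measure measure_box_of_measure) (simp add: g_def)
  qed (simp_all add: g_def)
  moreover have "g 1 = 1"
  proof -
    have [measurable]: "L' \<in> borel_measurable N" using seed by (simp add: levy_seed_def)
    let ?B = "box_of_measure 0 1"
    have B1: "?B \<in> finite_borel_sets" by (simp add: box_of_measure)
    note [measurable] = random_variable_L[OF B1]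
    have law: "distr M borel (L ?B) = distr N borel L'"
      by (intro law_L_seed) (simp_all add: box_of_measure measure_box_of_measure)
    have "expectation (\<lambda>\<omega>. f (L ?B \<omega>)) = (\<integral>\<omega>. f (L' \<omega>) \<partial>N)"
      if [measurable]: "f \<in> borel_measurable borel" for f :: "real \<Rightarrow> real"
    proof -
      have "expectation (\<lambda>\<omega>. f (L ?B \<omega>)) = (\<integral>x. f x \<partial>distr M borel (L ?B))"
        by (simp add: integral_distr)
      also have "\<dots> = (\<integral>\<omega>. f (L' \<omega>) \<partial>N)" unfolding law by (simp add: integral_distr)
      finally show ?thesis .
    qed
    from this[of "\<lambda>x. x"] this[of "\<lambda>x. (x - expectation (L ?B))\<^sup>2"] show ?thesis
      using variance_seed by (simp add: g_def Y_def)
  qed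
  ultimately show ?thesis using g[OF B] by simp
qed

lemma expectation_Y_fourth_Un:
  assumes "B \<in> finite_borel_sets" "C \<in> finite_borel_sets" "B \<inter> C = {}"
  shows "expectation (\<lambda>\<omega>. Y (B \<union> C) \<omega> ^ 4) = expectation (\<lambda>\<omega>. Y B \<omega> ^ 4) + expectation (\<lambda>\<omega>. Y C \<omega> ^ 4)
    + 6 * measure lborel B * measure lborel C"
proof -
  note i = Y_fourth_power_integrable[OF assms(1)] Y_fourth_power_integrable[OF assms(2)]
  have int: "integrable M (\<lambda>\<omega>. Y B \<omega> ^ 4)" "integrable M (\<lambda>\<omega>. Y C \<omega> ^ 4)"
    "integrable M (\<lambda>\<omega>. Y B \<omega> ^ 3 * Y C \<omega>)" "integrable M (\<lambda>\<omega>. Y B \<omega> ^ 2 * Y C \<omega> ^ 2)"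
    "integrable M (\<lambda>\<omega>. Y B \<omega> * Y C \<omega> ^ 3)"
    using integrable_mult4[OF i(1) i(1) i(1) i(1)] integrable_mult4[OF i(2) i(2) i(2) i(2)]
      integrable_mult4[OF i(1) i(1) i(1) i(2)] integrable_mult4[OF i(1) i(1) i(2) i(2)]
      integrable_mult4[OF i(1) i(2) i(2) i(2)]
    by (simp_all add: numeral_eq_Suc mult.assoc)
  have "expectation (\<lambda>\<omega>. Y (B \<union> C) \<omega> ^ 4) = expectation (\<lambda>\<omega>. (Y B \<omega> + Y C \<omega>) ^ 4)"
    using assms Y_Un[OF assms] Y_measurable by (intro integral_cong_AE) auto
  also have "\<dots> = expectation (\<lambda>\<omega>. Y B \<omega> ^ 4 + 4 * (Y B \<omega> ^ 3 * Y C \<omega>) + 6 * (Y B \<omega> ^ 2 * Y C \<omega> ^ 2)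
      + 4 * (Y B \<omega> * Y C \<omega> ^ 3) + Y C \<omega> ^ 4)"
    by (simp add: numeral_eq_Suc algebra_simps)
  also have "\<dots> = expectation (\<lambda>\<omega>. Y B \<omega> ^ 4) + 4 * expectation (\<lambda>\<omega>. Y B \<omega> ^ 3 * Y C \<omega>)
      + 6 * expectation (\<lambda>\<omega>. Y B \<omega> ^ 2 * Y C \<omega> ^ 2) + 4 * expectation (\<lambda>\<omega>. Y B \<omega> * Y C \<omega> ^ 3)
      + expectation (\<lambda>\<omega>. Y C \<omega> ^ 4)"
    using int by simp
  finally show ?thesis
    using expectation_Y_disjoint[OF assms, of 3 1] expectation_Y_disjoint[OF assms, of 2 2]
      expectation_Y_disjoint[OF assms, of 1 3] expectation_Y assms expectation_Y_square by simp
qed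

text \<open>The fourth cumulant of the seed, read off from a box of unit area, where the variance is \<open>1\<close>.\<close>

definition \<kappa> :: real where
  "\<kappa> = expectation (\<lambda>\<omega>. Y (box_of_measure 0 1) \<omega> ^ 4) - 3"

text \<open>The fourth cumulant \<open>g v = E (Y B ^ 4) - 3 v\<^sup>2\<close> of a set of area \<open>v\<close> is additive in \<open>v\<close>. It is bounded
  below by \<open>- 3 v\<^sup>2\<close>, and therefore nonnegative: \<open>g v = n * g (v / n) \<ge> - 3 v\<^sup>2 / n\<close> for every \<open>n\<close>. So it is
  linear in \<open>v\<close>.\<close>

lemma fourth_cumulant:
  shows expectation_Y_fourth: "B \<in> finite_borel_sets \<Longrightarrow>
      expectation (\<lambda>\<omega>. Y B \<omega> ^ 4) = \<kappa> * measure lborel B + 3 * (measure lborel B)\<^sup>2"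
    and \<kappa>_nonneg: "\<kappa> \<ge> 0"
proof -
  define g where "g v = expectation (\<lambda>\<omega>. Y (box_of_measure 0 v) \<omega> ^ 4) - 3 * v\<^sup>2" for v
  have g: "expectation (\<lambda>\<omega>. Y C \<omega> ^ 4) = g (measure lborel C) + 3 * (measure lborel C)\<^sup>2"
    if "C \<in> finite_borel_sets" for C
  proof -
    have "expectation (\<lambda>\<omega>. Y C \<omega> ^ 4) = expectation (\<lambda>\<omega>. Y (box_of_measure 0 (measure lborel C)) \<omega> ^ 4)"
      using that by (intro moment_Y_eq) (auto simp: box_of_measure measure_box_of_measure)
    then show ?thesis by (simp add: g_def)
  qed
  have add: "g (v + w) = g v + g w" if vw: "v \<ge> 0" "w \<ge> 0" for v w
  proof -
    have "box_of_measure 0 v \<inter> box_of_measure v w = {}" using box_of_measure_disjoint[of 0 v w] by simp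
    moreover have "box_of_measure 0 (v + w) = box_of_measure 0 v \<union> box_of_measure v w"
      using box_of_measure_Un[of v w 0] vw by simp
    ultimately show ?thesis
      using expectation_Y_fourth_Un[of "box_of_measure 0 v" "box_of_measure v w"] vw
        g[of "box_of_measure v w"]
      by (simp add: box_of_measure measure_box_of_measure) (simp add: g_def power2_eq_square algebra_simps)
  qed
  have nonneg: "g v \<ge> 0" if "v \<ge> 0" for v
  proof -
    have "g v \<ge> - (3 * v\<^sup>2) / real n" if "n \<ge> 1" for n :: nat
    proof -
      have "g (real n * (v / n)) = real n * g (v / n)"
        using add \<open>v \<ge> 0\<close> by (intro additive_of_nat_mult) auto
      moreover have "expectation (\<lambda>\<omega>. Y (box_of_measure 0 (v / n)) \<omega> ^ 4) \<ge> 0" by simp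
      then have "g (v / n) \<ge> - 3 * (v / n)\<^sup>2" by (simp add: g_def)
      then have "real n * g (v / n) \<ge> real n * (- 3 * (v / n)\<^sup>2)" by (intro mult_left_mono) auto
      ultimately show ?thesis using that by (simp add: power2_eq_square)
    qed
    moreover have "(\<lambda>n. - (3 * v\<^sup>2) / real n) \<longlonglongrightarrow> 0" by real_asymp
    ultimately show ?thesis
      by (intro tendsto_upperbound[of "\<lambda>n. - (3 * v\<^sup>2) / real n" 0 sequentially])
         (auto simp: eventually_sequentially)
  qed
  have \<kappa>: "g 1 = \<kappa>" by (simp add: g_def \<kappa>_def)
  show "\<kappa> \<ge> 0" using nonneg[of 1] \<kappa> by simp
  assume B: "B \<in> finite_borel_sets"
  have "g (measure lborel B) = measure lborel B * g 1"
    by (rule nonneg_additive_imp_linear) (use add nonneg in auto)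
  then show "expectation (\<lambda>\<omega>. Y B \<omega> ^ 4) = \<kappa> * measure lborel B + 3 * (measure lborel B)\<^sup>2"
    using g[OF B] \<kappa> by simp
qed

text \<open>Both sides are symmetric and additive in each argument, so their difference vanishes by polarisation once it
  does on the patterns that pairwise independence controls.\<close>

lemma fourth_moment_Y:
  assumes "B \<in> finite_borel_sets" "C \<in> finite_borel_sets" "E \<in> finite_borel_sets" "F \<in> finite_borel_sets"
  shows "expectation (\<lambda>\<omega>. Y B \<omega> * Y C \<omega> * Y E \<omega> * Y F \<omega>) =
    \<kappa> * measure lborel (B \<inter> C \<inter> E \<inter> F)
    + measure lborel (B \<inter> C) * measure lborel (E \<inter> F)
    + measure lborel (B \<inter> E) * measure lborel (C \<inter> F)
    + measure lborel (B \<inter> F) * measure lborel (C \<inter> E)"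
proof -
  define D where "D B C E F = expectation (\<lambda>\<omega>. Y B \<omega> * Y C \<omega> * Y E \<omega> * Y F \<omega>) -
    (\<kappa> * measure lborel (B \<inter> C \<inter> E \<inter> F)
    + measure lborel (B \<inter> C) * measure lborel (E \<inter> F)
    + measure lborel (B \<inter> E) * measure lborel (C \<inter> F)
    + measure lborel (B \<inter> F) * measure lborel (C \<inter> E))" for B C E F
  have "D B C E F = 0"
  proof (rule finite_borel.symmetric_4_additive_eq_0)
    fix B C P Q R :: "(real \<times> real) set"
    assume in_fbs: "B \<in> finite_borel_sets" "C \<in> finite_borel_sets" "P \<in> finite_borel_sets"
      "Q \<in> finite_borel_sets" "R \<in> finite_borel_sets" and BC: "B \<inter> C = {}"
    have "expectation (\<lambda>\<omega>. Y (B \<union> C) \<omega> * Y P \<omega> * Y Q \<omega> * Y R \<omega>)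
      = expectation (\<lambda>\<omega>. Y B \<omega> * Y P \<omega> * Y Q \<omega> * Y R \<omega> + Y C \<omega> * Y P \<omega> * Y Q \<omega> * Y R \<omega>)"
    proof (rule integral_cong_AE)
      show "AE \<omega> in M. Y (B \<union> C) \<omega> * Y P \<omega> * Y Q \<omega> * Y R \<omega>
          = Y B \<omega> * Y P \<omega> * Y Q \<omega> * Y R \<omega> + Y C \<omega> * Y P \<omega> * Y Q \<omega> * Y R \<omega>"
        using Y_Un[OF in_fbs(1,2) BC] by eventually_elim (simp add: algebra_simps)
    qed (use in_fbs Y_measurable in auto)
    also have "\<dots> = expectation (\<lambda>\<omega>. Y B \<omega> * Y P \<omega> * Y Q \<omega> * Y R \<omega>)
        + expectation (\<lambda>\<omega>. Y C \<omega> * Y P \<omega> * Y Q \<omega> * Y R \<omega>)"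
      using in_fbs by (intro Bochner_Integration.integral_add integrable_mult4) auto
    finally have *: "expectation (\<lambda>\<omega>. Y (B \<union> C) \<omega> * Y P \<omega> * Y Q \<omega> * Y R \<omega>) = \<dots>" .
    have m: "measure lborel ((B \<union> C) \<inter> S) = measure lborel (B \<inter> S) + measure lborel (C \<inter> S)"
      if "S \<in> finite_borel_sets" for S
      unfolding Int_Un_distrib2 using in_fbs BC that by (intro measure_finite_borel_Un) auto
    show "D (B \<union> C) P Q R = D B P Q R + D C P Q R"
      unfolding D_def * using in_fbs m[of P] m[of Q] m[of R] m[of "P \<inter> Q \<inter> R"]
      by (simp add: Int_assoc algebra_simps)
  next
    fix B C :: "(real \<times> real) set"
    assume B: "B \<in> finite_borel_sets" and C: "C \<in> finite_borel_sets" and BC: "B \<inter> C = {}"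
    show "D B B B C = 0"
      using expectation_Y_disjoint[OF B C BC, of 3 1] BC expectation_Y[OF C]
      by (simp add: D_def numeral_eq_Suc mult.assoc Int_assoc)
    show "D B B C C = 0"
      using expectation_Y_disjoint[OF B C BC, of 2 2] BC expectation_Y_square B C
      by (simp add: D_def numeral_eq_Suc mult.assoc Int_assoc)
  next
    fix B :: "(real \<times> real) set" assume B: "B \<in> finite_borel_sets"
    show "D B B B B = 0"
      using expectation_Y_fourth[OF B] by (simp add: D_def power4_eq power2_eq_square)
  qed (use assms in \<open>auto simp: D_def ac_simps Int_ac\<close>)
  then show ?thesis by (simp add: D_def)
qed

lemma second_moment_Y:
  assumes B: "B \<in> finite_borel_sets" and C: "C \<in> finite_borel_sets"
  shows "expectation (\<lambda>\<omega>. Y B \<omega> * Y C \<omega>) = measure lborel (B \<inter> C)"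
proof -
  let ?I = "B \<inter> C" and ?P = "B - C" and ?Q = "C - B"
  have m: "?I \<in> finite_borel_sets" "?P \<in> finite_borel_sets" "?Q \<in> finite_borel_sets" using B C by auto
  note i = m[THEN Y_fourth_power_integrable]
  have 1: "AE \<omega> in M. Y B \<omega> = Y ?I \<omega> + Y ?P \<omega>"
    using Y_Un[OF m(1,2)] by (metis Int_Diff_Un Int_Diff_disjoint)
  have 2: "AE \<omega> in M. Y C \<omega> = Y ?I \<omega> + Y ?Q \<omega>"
    using Y_Un[OF m(1,3)] by (metis Int_Diff_Un Int_Diff_disjoint Int_commute)
  have "expectation (\<lambda>\<omega>. Y B \<omega> * Y C \<omega>) = expectation (\<lambda>\<omega>. Y ?I \<omega> * Y ?I \<omega> + Y ?I \<omega> * Y ?Q \<omega>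
      + Y ?P \<omega> * Y ?I \<omega> + Y ?P \<omega> * Y ?Q \<omega>)"
  proof (rule integral_cong_AE)
    show "AE \<omega> in M. Y B \<omega> * Y C \<omega> = Y ?I \<omega> * Y ?I \<omega> + Y ?I \<omega> * Y ?Q \<omega>
      + Y ?P \<omega> * Y ?I \<omega> + Y ?P \<omega> * Y ?Q \<omega>"
      using 1 2 by eventually_elim (simp add: algebra_simps)
  qed (use B C m Y_measurable in auto)
  also have "\<dots> = expectation (\<lambda>\<omega>. Y ?I \<omega> * Y ?I \<omega>) + expectation (\<lambda>\<omega>. Y ?I \<omega> * Y ?Q \<omega>)
      + expectation (\<lambda>\<omega>. Y ?P \<omega> * Y ?I \<omega>) + expectation (\<lambda>\<omega>. Y ?P \<omega> * Y ?Q \<omega>)"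
    using integrable_mult2[OF i(1) i(1)] integrable_mult2[OF i(1) i(3)] integrable_mult2[OF i(2) i(1)]
      integrable_mult2[OF i(2) i(3)] by simp
  also have "\<dots> = measure lborel ?I"
    using expectation_Y_square[OF m(1)] expectation_Y m
      expectation_Y_disjoint[OF m(1,3), of 1 1] expectation_Y_disjoint[OF m(2,1), of 1 1]
      expectation_Y_disjoint[OF m(2,3), of 1 1]
    by (simp add: power2_eq_square Int_Diff Diff_Int_distrib2 Int_absorb1 disjoint_iff)
  finally show ?thesis .
qed

end

section \<open>Integrals of simple functions and sums of their products\<close>

text \<open>An algebra without unit that contains the indicators of sets of finite area; on it all the integrals in the
  moment formulas exist.\<close>

definition bounded_integrable :: "(real \<times> real \<Rightarrow> real) set" where
  "bounded_integrable = {f. integrable lborel f \<and> (\<exists>K. \<forall>x. \<bar>f x\<bar> \<le> K)}"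

lemma bounded_integrable_integrable: "f \<in> bounded_integrable \<Longrightarrow> integrable lborel f"
  by (simp add: bounded_integrable_def)

lemma bounded_integrable_mult:
  assumes "f \<in> bounded_integrable" "g \<in> bounded_integrable"
  shows "(\<lambda>x. f x * g x) \<in> bounded_integrable"
proof -
  obtain K where K: "\<And>x. \<bar>f x\<bar> \<le> K" using assms by (auto simp: bounded_integrable_def)
  obtain K' where K': "\<And>x. \<bar>g x\<bar> \<le> K'" using assms by (auto simp: bounded_integrable_def)
  have "integrable lborel (\<lambda>x. K * g x)"
    using assms by (simp add: bounded_integrable_def)
  then have "integrable lborel (\<lambda>x. f x * g x)"
  proof (rule Bochner_Integration.integrable_bound)
    show "(\<lambda>x. f x * g x) \<in> borel_measurable lborel"
      using assms by (auto simp: bounded_integrable_def)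
    have "0 \<le> K" using K[of undefined] by linarith
    then show "AE x in lborel. norm (f x * g x) \<le> norm (K * g x)"
      using K by (auto simp: abs_mult intro!: AE_I2 mult_right_mono)
  qed
  moreover have "\<bar>f x * g x\<bar> \<le> K * K'" for x
    using mult_mono[OF K[of x] K'[of x]] K[of x] by (simp add: abs_mult)
  ultimately show ?thesis by (auto simp: bounded_integrable_def)
qed

lemma bounded_integrable_diff:
  assumes "f \<in> bounded_integrable" "g \<in> bounded_integrable"
  shows "(\<lambda>x. f x - g x) \<in> bounded_integrable"
proof -
  obtain K where K: "\<And>x. \<bar>f x\<bar> \<le> K" using assms by (auto simp: bounded_integrable_def)
  obtain K' where K': "\<And>x. \<bar>g x\<bar> \<le> K'" using assms by (auto simp: bounded_integrable_def)
  have "\<bar>f x - g x\<bar> \<le> K + K'" for x using K[of x] K'[of x] by linarith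
  then show ?thesis using assms by (auto simp: bounded_integrable_def)
qed

lemma bounded_integrable_abs: "f \<in> bounded_integrable \<Longrightarrow> (\<lambda>x. \<bar>f x\<bar>) \<in> bounded_integrable"
  by (simp add: bounded_integrable_def)

lemma bounded_integrable_indicator:
  "B \<in> finite_borel_sets \<Longrightarrow> (indicator B :: _ \<Rightarrow> real) \<in> bounded_integrable"
  by (auto simp: bounded_integrable_def finite_borel_sets_def indicator_def intro!: exI[of _ 1])

lemma integral_indicator_finite_borel:
  "B \<in> finite_borel_sets \<Longrightarrow> (\<integral>x. indicator B x \<partial>lborel) = measure lborel B"
  by (simp add: finite_borel_sets_def)

context standardized_levy_basis
begin

text \<open>\<open>U\<close> is a version of the stochastic integral of \<open>f\<close> against the centred basis. Closing the indicators
  under differences is enough for the increments of a trawl process.\<close>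

inductive simple_integral :: "(real \<times> real \<Rightarrow> real) \<Rightarrow> ('a \<Rightarrow> real) \<Rightarrow> bool" where
  indicator: "B \<in> finite_borel_sets \<Longrightarrow> simple_integral (indicator B) (Y B)"
| diff: "simple_integral f U \<Longrightarrow> simple_integral g V \<Longrightarrow> simple_integral (\<lambda>x. f x - g x) (\<lambda>\<omega>. U \<omega> - V \<omega>)"

lemma simple_integral_bounded_integrable: "simple_integral f U \<Longrightarrow> f \<in> bounded_integrable"
  by (induction rule: simple_integral.induct) (simp_all add: bounded_integrable_indicator bounded_integrable_diff)

lemma simple_integral_fourth_power_integrable: "simple_integral f U \<Longrightarrow> U \<in> fourth_power_integrable M"
  by (induction rule: simple_integral.induct) (simp_all add: fourth_power_integrable_diff)

lemma simple_integral_second_moment: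
  assumes "simple_integral f U" "simple_integral g V"
  shows "expectation (\<lambda>\<omega>. U \<omega> * V \<omega>) = (\<integral>x. f x * g x \<partial>lborel)"
proof -
  have 1: "expectation (\<lambda>\<omega>. Y B \<omega> * V \<omega>) = (\<integral>x. indicator B x * g x \<partial>lborel)"
    if B: "B \<in> finite_borel_sets" and gV: "simple_integral g V" for B g V
    using gV
  proof (induction rule: simple_integral.induct)
    case (indicator C)
    have "B \<inter> C \<in> finite_borel_sets" using B indicator by simp
    then show ?case
      using second_moment_Y[OF B indicator] integral_indicator_finite_borel[of "B \<inter> C"]
      by (simp add: indicator_inter_arith)
  next
    case (diff g V h W)
    note i = simple_integral_fourth_power_integrable[OF diff(1)] simple_integral_fourth_power_integrable[OF diff(2)]
      and b = simple_integral_bounded_integrable[OF diff(1)] simple_integral_bounded_integrable[OF diff(2)]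
    have "integrable M (\<lambda>\<omega>. Y B \<omega> * V \<omega>)" "integrable M (\<lambda>\<omega>. Y B \<omega> * W \<omega>)"
      using i B by (auto intro!: integrable_mult2)
    moreover have "integrable lborel (\<lambda>x. indicator B x * g x)" "integrable lborel (\<lambda>x. indicator B x * h x)"
      using b B by (auto intro!: bounded_integrable_integrable bounded_integrable_mult bounded_integrable_indicator)
    ultimately show ?case using diff by (simp add: right_diff_distrib)
  qed
  show ?thesis using assms(1)
  proof (induction rule: simple_integral.induct)
    case (indicator B)
    then show ?case using 1 assms(2) by simp
  next
    case (diff g' V' h W)
    note i = simple_integral_fourth_power_integrable[OF diff(1)] simple_integral_fourth_power_integrable[OF diff(2)]
        simple_integral_fourth_power_integrable[OF assms(2)]
      and b = simple_integral_bounded_integrable[OF diff(1)] simple_integral_bounded_integrable[OF diff(2)]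
        simple_integral_bounded_integrable[OF assms(2)]
    have "integrable M (\<lambda>\<omega>. V' \<omega> * V \<omega>)" "integrable M (\<lambda>\<omega>. W \<omega> * V \<omega>)"
      using i by (auto intro!: integrable_mult2)
    moreover have "integrable lborel (\<lambda>x. g' x * g x)" "integrable lborel (\<lambda>x. h x * g x)"
      using b by (auto intro!: bounded_integrable_integrable bounded_integrable_mult)
    ultimately show ?case using diff by (simp add: left_diff_distrib)
  qed
qed

text \<open>The fourth moment of four stochastic integrals in terms of their integrands: Isserlis' formula for Gaussian
  variables with covariance form \<open>\<integral> f g\<close>, plus the contribution of the fourth cumulant.\<close>

definition fourth_moment_form :: "(real \<times> real \<Rightarrow> real) \<Rightarrow> (real \<times> real \<Rightarrow> real) \<Rightarrow>
    (real \<times> real \<Rightarrow> real) \<Rightarrow> (real \<times> real \<Rightarrow> real) \<Rightarrow> real" where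
  "fourth_moment_form f g h k =
    \<kappa> * (\<integral>x. f x * g x * h x * k x \<partial>lborel)
    + (\<integral>x. f x * g x \<partial>lborel) * (\<integral>x. h x * k x \<partial>lborel)
    + (\<integral>x. f x * h x \<partial>lborel) * (\<integral>x. g x * k x \<partial>lborel)
    + (\<integral>x. f x * k x \<partial>lborel) * (\<integral>x. g x * h x \<partial>lborel)"

lemma fourth_moment_form_rotate: "fourth_moment_form f g h k = fourth_moment_form g h k f"
  by (simp add: fourth_moment_form_def ac_simps)

lemma fourth_moment_form_diff:
  assumes "f \<in> bounded_integrable" "f' \<in> bounded_integrable" "g \<in> bounded_integrable"
    "h \<in> bounded_integrable" "k \<in> bounded_integrable"
  shows "fourth_moment_form (\<lambda>x. f x - f' x) g h k = fourth_moment_form f g h k - fourth_moment_form f' g h k"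
proof -
  have "integrable lborel (\<lambda>x. u x * g x * h x * k x)" "integrable lborel (\<lambda>x. u x * g x)"
    "integrable lborel (\<lambda>x. u x * h x)" "integrable lborel (\<lambda>x. u x * k x)"
    if "u \<in> {f, f'}" for u
    using assms that by (auto intro!: bounded_integrable_integrable bounded_integrable_mult)
  then show ?thesis
    by (simp add: fourth_moment_form_def left_diff_distrib) (simp add: algebra_simps)
qed

text \<open>Both sides are linear in each argument. \<open>step\<close> reduces the first argument to an indicator, and rotating the
  arguments brings each of them to the front once.\<close>

lemma simple_integral_fourth_moment:
  assumes "simple_integral f1 U1" "simple_integral f2 U2" "simple_integral f3 U3" "simple_integral f4 U4"
  shows "expectation (\<lambda>\<omega>. U1 \<omega> * U2 \<omega> * U3 \<omega> * U4 \<omega>) = fourth_moment_form f1 f2 f3 f4"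
proof -
  define P where "P f1 U1 f2 U2 f3 U3 f4 U4 \<longleftrightarrow>
    expectation (\<lambda>\<omega>. U1 \<omega> * U2 \<omega> * U3 \<omega> * U4 \<omega>) = fourth_moment_form f1 f2 f3 f4"
    for f1 U1 f2 U2 f3 U3 f4 U4
  have rotate: "P f1 U1 f2 U2 f3 U3 f4 U4 \<longleftrightarrow> P f2 U2 f3 U3 f4 U4 f1 U1" for f1 U1 f2 U2 f3 U3 f4 U4
    unfolding P_def fourth_moment_form_rotate[of f1] by (simp add: ac_simps)
  have step: "P f1 U1 f2 U2 f3 U3 f4 U4"
    if "simple_integral f1 U1" and s: "simple_integral f2 U2" "simple_integral f3 U3" "simple_integral f4 U4"
      and base: "\<And>B. B \<in> finite_borel_sets \<Longrightarrow> P (indicator B) (Y B) f2 U2 f3 U3 f4 U4"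
    for f1 U1 f2 U2 f3 U3 f4 U4
    using that(1)
  proof (induction rule: simple_integral.induct)
    case (diff f U g V)
    note S = diff(1,2) s
    have "expectation (\<lambda>\<omega>. (U \<omega> - V \<omega>) * U2 \<omega> * U3 \<omega> * U4 \<omega>)
        = expectation (\<lambda>\<omega>. U \<omega> * U2 \<omega> * U3 \<omega> * U4 \<omega>) - expectation (\<lambda>\<omega>. V \<omega> * U2 \<omega> * U3 \<omega> * U4 \<omega>)"
      using integrable_mult4[OF S(1,3-5)[THEN simple_integral_fourth_power_integrable]]
        integrable_mult4[OF S(2-5)[THEN simple_integral_fourth_power_integrable]]
      by (simp add: left_diff_distrib)
    also have "\<dots> = fourth_moment_form (\<lambda>x. f x - g x) f2 f3 f4"
      using diff(3,4) fourth_moment_form_diff[OF S[THEN simple_integral_bounded_integrable]]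
      by (simp add: P_def)
    finally show ?case by (simp add: P_def)
  qed (rule base)
  have ind: "P (indicator B) (Y B) (indicator C) (Y C) (indicator E) (Y E) (indicator F) (Y F)"
    if BCEF: "B \<in> finite_borel_sets" "C \<in> finite_borel_sets" "E \<in> finite_borel_sets" "F \<in> finite_borel_sets"
    for B C E F
  proof -
    have "(\<integral>x. indicator (S :: (real \<times> real) set) x * indicator S' x \<partial>lborel) = measure lborel (S \<inter> S')"
      if "S \<in> finite_borel_sets" "S' \<in> finite_borel_sets" for S S'
      using integral_indicator_finite_borel[of "S \<inter> S'"] that by (simp add: indicator_inter_arith)
    moreover have "(\<integral>x. indicator B x * indicator C x * indicator E x * indicator F x \<partial>lborel)
        = measure lborel (B \<inter> C \<inter> E \<inter> F)"
      using integral_indicator_finite_borel[of "B \<inter> C \<inter> E \<inter> F"] BCEF by (simp add: indicator_inter_arith)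
    ultimately show ?thesis
      using fourth_moment_Y[OF BCEF] BCEF by (simp add: P_def fourth_moment_form_def)
  qed
  note s = simple_integral.indicator
  have "P f1 U1 f2 U2 f3 U3 f4 U4"
  proof (rule step[OF assms])
    fix B assume B: "B \<in> finite_borel_sets"
    have "P f2 U2 f3 U3 f4 U4 (indicator B) (Y B)"
    proof (rule step[OF assms(2-4) s[OF B]])
      fix C assume C: "C \<in> finite_borel_sets"
      have "P f3 U3 f4 U4 (indicator B) (Y B) (indicator C) (Y C)"
      proof (rule step[OF assms(3,4) s[OF B] s[OF C]])
        fix E assume E: "E \<in> finite_borel_sets"
        have "P f4 U4 (indicator B) (Y B) (indicator C) (Y C) (indicator E) (Y E)"
        proof (rule step[OF assms(4) s[OF B] s[OF C] s[OF E]])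
          fix F assume F: "F \<in> finite_borel_sets"
          show "P (indicator F) (Y F) (indicator B) (Y B) (indicator C) (Y C) (indicator E) (Y E)"
            by (rule ind[OF F B C E])
        qed
        then show "P (indicator E) (Y E) f4 U4 (indicator B) (Y B) (indicator C) (Y C)"
          by (subst rotate)
      qed
      then show "P (indicator C) (Y C) f3 U3 f4 U4 (indicator B) (Y B)"
        by (subst rotate)
    qed
    then show "P (indicator B) (Y B) f2 U2 f3 U3 f4 U4"
      by (subst rotate)
  qed
  then show ?thesis by (simp add: P_def)
qed

text \<open>In the double sum of covariances, the two terms of the moment formula that contain \<open>v k * v j\<close> are bounded by
  \<open>\<kappa> + K\<close> times \<open>\<integral> |v k| |v j|\<close>, and the remaining one by \<open>\<eta>\<close> times \<open>\<integral> |u k| |v j|\<close>. Summing over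
  \<open>j\<close> inside the integral costs only the factor \<open>2\<close>, so the bound grows linearly in \<open>m\<close>.\<close>

lemma variance_sum_products_le:
  fixes u v :: "nat \<Rightarrow> real \<times> real \<Rightarrow> real" and U V :: "nat \<Rightarrow> 'a \<Rightarrow> real"
  assumes u: "\<And>k. simple_integral (u k) (U k)" and v: "\<And>k. simple_integral (v k) (V k)"
    and u_le: "\<And>k x. \<bar>u k x\<bar> \<le> 1" and v_sum_le: "\<And>x. (\<Sum>k<m. \<bar>v k x\<bar>) \<le> 2"
    and int_u: "\<And>k. (\<integral>x. \<bar>u k x\<bar> \<partial>lborel) \<le> K" and int_v: "\<And>k. (\<integral>x. \<bar>v k x\<bar> \<partial>lborel) \<le> \<eta>"
  shows "expectation (\<lambda>\<omega>. ((\<Sum>k<m. U k \<omega> * V k \<omega>) - (\<Sum>k<m. \<integral>x. u k x * v k x \<partial>lborel))\<^sup>2)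
    \<le> 2 * real m * \<eta> * (\<kappa> + 2 * K)"
    and "integrable M (\<lambda>\<omega>. ((\<Sum>k<m. U k \<omega> * V k \<omega>) - (\<Sum>k<m. \<integral>x. u k x * v k x \<partial>lborel))\<^sup>2)"
proof -
  define c where "c k = (\<integral>x. u k x * v k x \<partial>lborel)" for k
  note U4 = u[THEN simple_integral_fourth_power_integrable] and V4 = v[THEN simple_integral_fourth_power_integrable]
  note ub = u[THEN simple_integral_bounded_integrable] and vb = v[THEN simple_integral_bounded_integrable]
  have abs_int: "integrable lborel (\<lambda>x. \<bar>v k x\<bar>)" "integrable lborel (\<lambda>x. \<bar>u k x\<bar>)"
    "integrable lborel (\<lambda>x. \<bar>v k x\<bar> * \<bar>v j x\<bar>)" "integrable lborel (\<lambda>x. \<bar>u k x\<bar> * \<bar>v j x\<bar>)"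
    "integrable lborel (\<lambda>x. \<bar>u k x\<bar> * \<bar>u j x\<bar>)" "integrable lborel (\<lambda>x. \<bar>v k x\<bar> * \<bar>u j x\<bar>)" for k j
    by (intro bounded_integrable_integrable bounded_integrable_mult bounded_integrable_abs ub vb)+
  have UV: "integrable M (\<lambda>\<omega>. U k \<omega> * V k \<omega>)" for k
    by (intro integrable_mult2 U4 V4)
  have UVUV: "integrable M (\<lambda>\<omega>. (U k \<omega> * V k \<omega>) * (U j \<omega> * V j \<omega>))" for k j
    using integrable_mult4[OF U4[of k] V4[of k] U4[of j] V4[of j]] by (simp add: mult.assoc)
  define T where "T k j \<omega> = (U k \<omega> * V k \<omega> - c k) * (U j \<omega> * V j \<omega> - c j)" for k j \<omega>
  have T_eq: "T k j = (\<lambda>\<omega>. (U k \<omega> * V k \<omega>) * (U j \<omega> * V j \<omega>) - c j * (U k \<omega> * V k \<omega>)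
      - c k * (U j \<omega> * V j \<omega>) + c k * c j)" for k j
    by (auto simp: T_def algebra_simps)
  have T_int: "integrable M (T k j)" for k j
    unfolding T_eq using UV UVUV by simp
  have E_T: "expectation (T k j) = \<kappa> * (\<integral>x. u k x * v k x * u j x * v j x \<partial>lborel)
      + (\<integral>x. u k x * u j x \<partial>lborel) * (\<integral>x. v k x * v j x \<partial>lborel)
      + (\<integral>x. u k x * v j x \<partial>lborel) * (\<integral>x. v k x * u j x \<partial>lborel)" for k j
  proof -
    have "expectation (T k j) = expectation (\<lambda>\<omega>. (U k \<omega> * V k \<omega>) * (U j \<omega> * V j \<omega>))
        - c j * expectation (\<lambda>\<omega>. U k \<omega> * V k \<omega>) - c k * expectation (\<lambda>\<omega>. U j \<omega> * V j \<omega>) + c k * c j"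
      unfolding T_eq using UV UVUV by (simp add: prob_space)
    also have "expectation (\<lambda>\<omega>. (U k \<omega> * V k \<omega>) * (U j \<omega> * V j \<omega>)) = fourth_moment_form (u k) (v k) (u j) (v j)"
      using simple_integral_fourth_moment[OF u v u v, of k k j j] by (simp add: mult.assoc)
    finally show ?thesis
      using simple_integral_second_moment[OF u v] by (simp add: fourth_moment_form_def c_def)
  qed
  have E_T_le: "expectation (T k j) \<le> (\<kappa> + K) * (\<integral>x. \<bar>v k x\<bar> * \<bar>v j x\<bar> \<partial>lborel)
      + \<eta> * (\<integral>x. \<bar>u k x\<bar> * \<bar>v j x\<bar> \<partial>lborel)" for k j
  proof -
    have "(\<integral>x. u k x * v k x * u j x * v j x \<partial>lborel) \<le> (\<integral>x. \<bar>v k x\<bar> * \<bar>v j x\<bar> \<partial>lborel)"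
    proof (rule integral_mono)
      show "integrable lborel (\<lambda>x. u k x * v k x * u j x * v j x)"
        by (intro bounded_integrable_integrable bounded_integrable_mult ub vb)
      show "u k x * v k x * u j x * v j x \<le> \<bar>v k x\<bar> * \<bar>v j x\<bar>" for x
      proof -
        have "\<bar>u k x\<bar> * \<bar>u j x\<bar> \<le> 1" using u_le[of k x] u_le[of j x] by (simp add: mult_le_one)
        then have "(\<bar>u k x\<bar> * \<bar>u j x\<bar>) * (\<bar>v k x\<bar> * \<bar>v j x\<bar>) \<le> 1 * (\<bar>v k x\<bar> * \<bar>v j x\<bar>)"
          by (intro mult_right_mono) auto
        moreover have "u k x * v k x * u j x * v j x \<le> \<bar>u k x * v k x * u j x * v j x\<bar>" by simp
        ultimately show ?thesis by (simp add: abs_mult ac_simps)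
      qed
    qed (rule abs_int)
    then have 1: "\<kappa> * (\<integral>x. u k x * v k x * u j x * v j x \<partial>lborel) \<le> \<kappa> * (\<integral>x. \<bar>v k x\<bar> * \<bar>v j x\<bar> \<partial>lborel)"
      by (intro mult_left_mono \<kappa>_nonneg)
    have abs_le: "\<bar>\<integral>x. f x * g x \<partial>lborel\<bar> \<le> (\<integral>x. \<bar>f x\<bar> * \<bar>g x\<bar> \<partial>lborel)" for f g :: "real \<times> real \<Rightarrow> real"
      unfolding abs_mult[symmetric] by (rule integral_abs_bound)
    have abs_mult_le: "a * b \<le> A * B" if "\<bar>a\<bar> \<le> A" "\<bar>b\<bar> \<le> B" for a b A B :: real
    proof -
      have "a * b \<le> \<bar>a\<bar> * \<bar>b\<bar>" by (simp flip: abs_mult)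
      also have "\<dots> \<le> A * B" using that by (intro mult_mono) auto
      finally show ?thesis .
    qed
    have uu: "\<bar>\<integral>x. u k x * u j x \<partial>lborel\<bar> \<le> K"
    proof -
      have "(\<integral>x. \<bar>u k x\<bar> * \<bar>u j x\<bar> \<partial>lborel) \<le> (\<integral>x. \<bar>u k x\<bar> \<partial>lborel)"
        by (intro integral_mono abs_int mult_left_le u_le abs_ge_zero)
      then show ?thesis using abs_le[of "u k" "u j"] int_u[of k] by linarith
    qed
    have vu: "\<bar>\<integral>x. v k x * u j x \<partial>lborel\<bar> \<le> \<eta>"
    proof -
      have "(\<integral>x. \<bar>v k x\<bar> * \<bar>u j x\<bar> \<partial>lborel) \<le> (\<integral>x. \<bar>v k x\<bar> \<partial>lborel)"
        by (intro integral_mono abs_int mult_left_le u_le abs_ge_zero)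
      then show ?thesis using abs_le[of "v k" "u j"] int_v[of k] by linarith
    qed
    have "(\<integral>x. u k x * u j x \<partial>lborel) * (\<integral>x. v k x * v j x \<partial>lborel) \<le> K * (\<integral>x. \<bar>v k x\<bar> * \<bar>v j x\<bar> \<partial>lborel)"
      by (rule abs_mult_le[OF uu abs_le])
    moreover have "(\<integral>x. u k x * v j x \<partial>lborel) * (\<integral>x. v k x * u j x \<partial>lborel) \<le> \<eta> * (\<integral>x. \<bar>u k x\<bar> * \<bar>v j x\<bar> \<partial>lborel)"
      by (rule order_trans[OF eq_refl[OF mult.commute] abs_mult_le[OF vu abs_le]])
    ultimately show ?thesis using 1 unfolding E_T by (simp add: distrib_right)
  qed
  have "0 \<le> (\<integral>x. \<bar>u 0 x\<bar> \<partial>lborel)" "0 \<le> (\<integral>x. \<bar>v 0 x\<bar> \<partial>lborel)" by simp_all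
  then have nonneg: "0 \<le> K" "0 \<le> \<eta>" using int_u[of 0] int_v[of 0] by linarith+
  have inner: "(\<Sum>j<m. expectation (T k j)) \<le> 2 * \<eta> * (\<kappa> + 2 * K)" for k
  proof -
    have sum_v: "(\<Sum>j<m. \<integral>x. \<bar>w x\<bar> * \<bar>v j x\<bar> \<partial>lborel) \<le> 2 * (\<integral>x. \<bar>w x\<bar> \<partial>lborel)"
      if "integrable lborel (\<lambda>x. \<bar>w x\<bar>)" "\<And>j. integrable lborel (\<lambda>x. \<bar>w x\<bar> * \<bar>v j x\<bar>)" for w :: "real \<times> real \<Rightarrow> real"
    proof -
      have "(\<Sum>j<m. \<integral>x. \<bar>w x\<bar> * \<bar>v j x\<bar> \<partial>lborel) = (\<integral>x. (\<Sum>j<m. \<bar>w x\<bar> * \<bar>v j x\<bar>) \<partial>lborel)"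
        using that by (intro Bochner_Integration.integral_sum[symmetric]) auto
      also have "\<dots> \<le> (\<integral>x. 2 * \<bar>w x\<bar> \<partial>lborel)"
      proof (rule integral_mono)
        show "(\<Sum>j<m. \<bar>w x\<bar> * \<bar>v j x\<bar>) \<le> 2 * \<bar>w x\<bar>" for x
          using mult_left_mono[OF v_sum_le[of x], of "\<bar>w x\<bar>"] by (simp add: sum_distrib_left mult.commute)
      qed (use that in auto)
      finally show ?thesis by simp
    qed
    have "(\<Sum>j<m. expectation (T k j)) \<le> (\<Sum>j<m. (\<kappa> + K) * (\<integral>x. \<bar>v k x\<bar> * \<bar>v j x\<bar> \<partial>lborel)
      + \<eta> * (\<integral>x. \<bar>u k x\<bar> * \<bar>v j x\<bar> \<partial>lborel))"
      by (intro sum_mono E_T_le)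
    also have "\<dots> = (\<kappa> + K) * (\<Sum>j<m. \<integral>x. \<bar>v k x\<bar> * \<bar>v j x\<bar> \<partial>lborel)
        + \<eta> * (\<Sum>j<m. \<integral>x. \<bar>u k x\<bar> * \<bar>v j x\<bar> \<partial>lborel)"
      by (simp add: sum.distrib sum_distrib_left)
    also have "\<dots> \<le> (\<kappa> + K) * (2 * \<eta>) + \<eta> * (2 * K)"
      using sum_v[of "v k"] sum_v[of "u k"] abs_int int_u[of k] int_v[of k] nonneg \<kappa>_nonneg
      by (intro add_mono mult_left_mono) (auto intro: order_trans)
    finally show ?thesis by (simp add: algebra_simps)
  qed
  have sq: "((\<Sum>k<m. U k \<omega> * V k \<omega>) - (\<Sum>k<m. c k))\<^sup>2 = (\<Sum>k<m. \<Sum>j<m. T k j \<omega>)" for \<omega>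
    unfolding T_def by (simp add: power2_eq_square sum_product flip: sum_subtractf)
  show "integrable M (\<lambda>\<omega>. ((\<Sum>k<m. U k \<omega> * V k \<omega>) - (\<Sum>k<m. \<integral>x. u k x * v k x \<partial>lborel))\<^sup>2)"
    unfolding c_def[symmetric] sq using T_int by simp
  have "expectation (\<lambda>\<omega>. ((\<Sum>k<m. U k \<omega> * V k \<omega>) - (\<Sum>k<m. c k))\<^sup>2) = (\<Sum>k<m. \<Sum>j<m. expectation (T k j))"
    unfolding sq using T_int by simp
  also have "\<dots> \<le> (\<Sum>k<m. 2 * \<eta> * (\<kappa> + 2 * K))"
    by (intro sum_mono inner)
  also have "\<dots> = 2 * real m * \<eta> * (\<kappa> + 2 * K)" by simp
  finally show "expectation (\<lambda>\<omega>. ((\<Sum>k<m. U k \<omega> * V k \<omega>) - (\<Sum>k<m. \<integral>x. u k x * v k x \<partial>lborel))\<^sup>2)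
    \<le> 2 * real m * \<eta> * (\<kappa> + 2 * K)"
    unfolding c_def .
qed

end

section \<open>Geometry of trawl sets\<close>

definition shifted_trawl :: "(real \<Rightarrow> real) \<Rightarrow> real \<Rightarrow> (real \<times> real) set" where
  "shifted_trawl a s = {(r, y). r \<le> s \<and> 0 \<le> y \<and> y \<le> a (s - r)}"

lemma shifted_trawl_eq_translate: "(\<lambda>p. p + (s, 0)) ` trawl_set a = shifted_trawl a s"
proof (intro set_eqI iffI)
  fix p assume "p \<in> shifted_trawl a s"
  then have "p - (s, 0) \<in> trawl_set a" by (auto simp: shifted_trawl_def trawl_set_def)
  then show "p \<in> (\<lambda>p. p + (s, 0)) ` trawl_set a"
    by (intro image_eqI[of _ _ "p - (s, 0)"]) auto
qed (auto simp: shifted_trawl_def trawl_set_def)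

definition tail_area :: "(real \<Rightarrow> real) \<Rightarrow> real \<Rightarrow> real" where
  "tail_area a h = (LINT x:{h..}|lborel. a x)"

text \<open>A point belongs to \<open>S k\<close> exactly for \<open>k\<close> in an interval, so its indicator jumps up at most once and down at
  most once. The induction records which of these jumps can have happened up to \<open>m\<close>.\<close>

lemma sum_abs_indicator_increments_le_2:
  fixes S :: "nat \<Rightarrow> 'x set"
  assumes convex: "\<And>i j k. i \<le> j \<Longrightarrow> j \<le> k \<Longrightarrow> S i \<inter> S k \<subseteq> S j"
  shows "(\<Sum>k<m. \<bar>indicator (S (Suc k)) x - indicator (S k) x\<bar>) \<le> (2 :: real)"
proof -
  have "(\<Sum>k<m. \<bar>indicator (S (Suc k)) x - indicator (S k) x\<bar>)
    \<le> (if x \<in> S m then 1 else if \<exists>k\<le>m. x \<in> S k then 2 else (0 :: real))"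
  proof (induction m)
    case (Suc m)
    show ?case
    proof (cases "x \<in> S m")
      case True
      then have "\<exists>k\<le>Suc m. x \<in> S k" by (intro exI[of _ m]) simp
      then show ?thesis using Suc True by (simp add: indicator_def)
    next
      case out: False
      show ?thesis
      proof (cases "x \<in> S (Suc m)")
        case True
        have "\<not> (\<exists>k\<le>m. x \<in> S k)" using convex[of _ m "Suc m"] True out by auto
        then show ?thesis using Suc True out by (simp add: indicator_def)
      next
        case False
        then show ?thesis using Suc out by (auto simp: indicator_def le_Suc_eq split: if_splits)
      qed
    qed
  qed simp
  also have "\<dots> \<le> 2" by simp
  finally show ?thesis .
qed

text \<open>The integrand of the increment of the trawl process over the \<open>k\<close>-th sampling interval of length \<open>d\<close>.\<close>

definition trawl_increment :: "(real \<Rightarrow> real) \<Rightarrow> real \<Rightarrow> nat \<Rightarrow> real \<times> real \<Rightarrow> real" where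
  "trawl_increment a d k x = indicator (shifted_trawl a (real (k + 1) * d)) x
    - indicator (shifted_trawl a (real k * d)) x"

lemma abs_trawl_increment: "\<bar>trawl_increment a d k x\<bar> = (trawl_increment a d k x)\<^sup>2"
  by (simp add: trawl_increment_def indicator_def)

lemma abs_trawl_increment_le_1: "\<bar>trawl_increment a d k x\<bar> \<le> 1"
  by (simp add: trawl_increment_def indicator_def)

context
  fixes a :: "real \<Rightarrow> real"
  assumes a: "trawl_function a"
begin

lemma trawl_nonneg: "s \<ge> 0 \<Longrightarrow> 0 \<le> a s"
  and trawl_continuous: "continuous_on {0..} a"
  and trawl_antimono: "0 \<le> s \<Longrightarrow> s \<le> t \<Longrightarrow> a t \<le> a s"
  and trawl_integrable: "set_integrable lborel {0..} a"
  using a by (auto simp: trawl_function_def monotone_on_def)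

lemma trawl_tail_integrable: "h \<ge> 0 \<Longrightarrow> set_integrable lborel {h..} a"
  by (rule set_integrable_subset[OF trawl_integrable]) auto

lemma shifted_trawl_Int:
  "s \<le> t \<Longrightarrow> shifted_trawl a s \<inter> shifted_trawl a t = {(r, y). r \<le> s \<and> 0 \<le> y \<and> y \<le> a (t - r)}"
proof (intro set_eqI iffI)
  fix p assume st: "s \<le> t" and "p \<in> {(r, y). r \<le> s \<and> 0 \<le> y \<and> y \<le> a (t - r)}"
  then obtain r y where p: "p = (r, y)" "r \<le> s" "0 \<le> y" "y \<le> a (t - r)" by auto
  with st trawl_antimono[of "s - r" "t - r"] show "p \<in> shifted_trawl a s \<inter> shifted_trawl a t"
    by (simp add: shifted_trawl_def)
qed (auto simp: shifted_trawl_def)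

lemma shifted_trawl_convex:
  "s \<le> t \<Longrightarrow> t \<le> u \<Longrightarrow> shifted_trawl a s \<inter> shifted_trawl a u \<subseteq> shifted_trawl a t"
proof
  fix p assume tu: "s \<le> t" "t \<le> u" and "p \<in> shifted_trawl a s \<inter> shifted_trawl a u"
  then obtain r y where p: "p = (r, y)" "r \<le> s" "0 \<le> y" "y \<le> a (u - r)" by (auto simp: shifted_trawl_def)
  with tu trawl_antimono[of "t - r" "u - r"] show "p \<in> shifted_trawl a t"
    by (simp add: shifted_trawl_def)
qed

text \<open>For \<open>s \<le> t\<close> the vertical section of the intersection at \<open>r \<le> s\<close> is \<open>[0, a (t - r)]\<close>, because \<open>a\<close> is
  non-increasing; the area follows by Fubini and the substitution \<open>x = t - r\<close>.\<close>

lemma emeasure_shifted_trawl_Int: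
  assumes "s \<le> t"
  shows "emeasure lborel (shifted_trawl a s \<inter> shifted_trawl a t) = ennreal (tail_area a (t - s))"
    and "shifted_trawl a s \<inter> shifted_trawl a t \<in> sets borel"
proof -
  define S where "S = shifted_trawl a s \<inter> shifted_trawl a t"
  \<comment> \<open>A continuous extension of \<open>a\<close> to the whole line, so that the intersection is visibly closed.\<close>
  define g where "g x = a (max 0 x)" for x
  have g: "continuous_on UNIV g"
    unfolding g_def by (rule continuous_on_compose2[OF trawl_continuous]) (auto intro!: continuous_intros)
  have S_eq: "S = {p. fst p \<le> s} \<inter> {p. 0 \<le> snd p} \<inter> {p. snd p \<le> g (t - fst p)}"
    unfolding S_def shifted_trawl_Int[OF assms] using assms by (auto simp: g_def)
  have "closed S"
    unfolding S_eq by (intro closed_Int closed_Collect_le continuous_intros continuous_on_compose2[OF g]) auto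
  then show S: "shifted_trawl a s \<inter> shifted_trawl a t \<in> sets borel" unfolding S_def by simp
  define F where "F x = ennreal (indicator {t - s..} x * a x)" for x
  have int: "integrable lborel (\<lambda>x. indicator {t - s..} x * a x)"
    using trawl_tail_integrable[of "t - s"] assms by (simp add: set_integrable_def)
  then have F: "F \<in> borel_measurable borel" unfolding F_def by measurable
  have "S \<in> sets (lborel \<Otimes>\<^sub>M lborel)" unfolding lborel_prod using S by (simp add: S_def)
  then have "emeasure lborel S = (\<integral>\<^sup>+r. emeasure lborel (Pair r -` S) \<partial>lborel)"
    unfolding lborel_prod[symmetric] by (rule lborel.emeasure_pair_measure_alt)
  also have "\<dots> = (\<integral>\<^sup>+r. F (t + (-1) * r) \<partial>lborel)"
  proof (rule nn_integral_cong)
    fix r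
    have "Pair r -` S = (if r \<le> s then {0..a (t - r)} else {})"
      unfolding S_def shifted_trawl_Int[OF assms] by auto
    then show "emeasure lborel (Pair r -` S) = F (t + (-1) * r)"
      using assms trawl_nonneg[of "t - r"] by (auto simp: F_def indicator_def)
  qed
  also have "\<dots> = (\<integral>\<^sup>+x. F x \<partial>lborel)"
    using nn_integral_real_affine[OF F, of "-1" t] by simp
  also have "\<dots> = ennreal (\<integral>x. indicator {t - s..} x * a x \<partial>lborel)"
    unfolding F_def using int assms trawl_nonneg by (intro nn_integral_eq_integral) (auto simp: indicator_def)
  finally show "emeasure lborel (shifted_trawl a s \<inter> shifted_trawl a t) = ennreal (tail_area a (t - s))"
    by (simp add: S_def tail_area_def set_lebesgue_integral_def)
qed

lemma tail_area_nonneg: "h \<ge> 0 \<Longrightarrow> tail_area a h \<ge> 0"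
  unfolding tail_area_def set_lebesgue_integral_def using trawl_nonneg
  by (intro Bochner_Integration.integral_nonneg) (auto simp: indicator_def)

lemma shifted_trawl_finite: "shifted_trawl a s \<in> finite_borel_sets"
  using emeasure_shifted_trawl_Int[of s s] by (simp add: finite_borel_sets_def)

lemma measure_shifted_trawl_Int:
  "measure lborel (shifted_trawl a s \<inter> shifted_trawl a t) = tail_area a \<bar>t - s\<bar>"
proof (cases "s \<le> t")
  case True
  then show ?thesis using emeasure_shifted_trawl_Int[of s t] tail_area_nonneg by (simp add: measure_def)
next
  case False
  then show ?thesis using emeasure_shifted_trawl_Int[of t s] tail_area_nonneg
    by (simp add: measure_def Int_commute)
qed

lemma integral_indicator_shifted_trawl:
  "(\<integral>x. indicator (shifted_trawl a s) x * indicator (shifted_trawl a t) x \<partial>lborel) = tail_area a \<bar>t - s\<bar>"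
  using integral_indicator_finite_borel[of "shifted_trawl a s \<inter> shifted_trawl a t"]
  by (simp add: shifted_trawl_finite measure_shifted_trawl_Int indicator_inter_arith)

lemma tail_area_diff_bounds:
  assumes "0 \<le> h" "h \<le> h'"
  shows "(h' - h) * a h' \<le> tail_area a h - tail_area a h'"
    and "tail_area a h - tail_area a h' \<le> (h' - h) * a h"
proof -
  have int: "set_integrable lborel {h..<h'} a"
    by (rule set_integrable_subset[OF trawl_integrable]) (use assms in auto)
  have "{h..} = {h..<h'} \<union> {h'..}" "{h..<h'} \<inter> {h'..} = {}" using assms by auto
  then have "tail_area a h = (LINT x:{h..<h'}|lborel. a x) + tail_area a h'"
    unfolding tail_area_def
    using set_integral_Un[of "{h..<h'}" "{h'..}" lborel a] int trawl_tail_integrable[of h'] assms by auto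
  then have eq: "tail_area a h - tail_area a h' = (LINT x:{h..<h'}|lborel. a x)" by simp
  have const: "set_integrable lborel {h..<h'} (\<lambda>_. c)" "(LINT x:{h..<h'}|lborel. c) = (h' - h) * c" for c :: real
    using assms by (simp_all add: set_integrable_def set_lebesgue_integral_def)
  have "(LINT x:{h..<h'}|lborel. a h') \<le> (LINT x:{h..<h'}|lborel. a x)"
    using assms by (intro set_integral_mono const int trawl_antimono) auto
  moreover have "(LINT x:{h..<h'}|lborel. a x) \<le> (LINT x:{h..<h'}|lborel. a h)"
    using assms by (intro set_integral_mono const int trawl_antimono) auto
  ultimately show "(h' - h) * a h' \<le> tail_area a h - tail_area a h'"
    "tail_area a h - tail_area a h' \<le> (h' - h) * a h"
    unfolding eq const by auto
qed

lemma sum_abs_trawl_increment_le_2: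
  assumes "d > 0"
  shows "(\<Sum>k<m. \<bar>trawl_increment a d (k + l) x\<bar>) \<le> 2"
  using sum_abs_indicator_increments_le_2[of "\<lambda>k. shifted_trawl a (real (k + l) * d)" x m] assms
  by (simp add: trawl_increment_def shifted_trawl_convex mult_right_mono)

lemma integral_trawl_increment_square:
  assumes "d > 0"
  shows "(\<integral>x. (trawl_increment a d k x)\<^sup>2 \<partial>lborel) = 2 * (tail_area a 0 - tail_area a d)"
proof -
  let ?f = "indicator (shifted_trawl a (real (k + 1) * d)) :: real \<times> real \<Rightarrow> real"
    and ?g = "indicator (shifted_trawl a (real k * d)) :: real \<times> real \<Rightarrow> real"
  have int: "integrable lborel (\<lambda>x. ?f x * ?f x)" "integrable lborel (\<lambda>x. ?f x * ?g x)"
      "integrable lborel (\<lambda>x. ?g x * ?g x)"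
    by (intro bounded_integrable_integrable bounded_integrable_mult bounded_integrable_indicator
        shifted_trawl_finite)+
  have "(trawl_increment a d k x)\<^sup>2 = ?f x * ?f x - 2 * (?f x * ?g x) + ?g x * ?g x" for x
    by (simp add: trawl_increment_def power2_eq_square algebra_simps)
  then have "(\<integral>x. (trawl_increment a d k x)\<^sup>2 \<partial>lborel) = (\<integral>x. ?f x * ?f x \<partial>lborel)
      - 2 * (\<integral>x. ?f x * ?g x \<partial>lborel) + (\<integral>x. ?g x * ?g x \<partial>lborel)"
    using int by simp
  also have "\<dots> = 2 * (tail_area a 0 - tail_area a d)"
    unfolding integral_indicator_shifted_trawl using assms by (simp add: algebra_simps)
  finally show ?thesis .
qed

lemma integral_abs_trawl_increment_le:
  assumes "d > 0"
  shows "(\<integral>x. \<bar>trawl_increment a d k x\<bar> \<partial>lborel) \<le> 2 * d * a 0"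
  unfolding abs_trawl_increment integral_trawl_increment_square[OF assms]
  using tail_area_diff_bounds(2)[of 0 d] assms by simp

lemma integral_trawl_times_increment:
  assumes "d > 0"
  shows "(\<integral>x. indicator (shifted_trawl a (real k * d)) x * trawl_increment a d (k + l) x \<partial>lborel)
    = tail_area a (real (l + 1) * d) - tail_area a (real l * d)"
proof -
  let ?i = "\<lambda>k. indicator (shifted_trawl a (real k * d)) :: real \<times> real \<Rightarrow> real"
  have int: "integrable lborel (\<lambda>x. ?i k x * ?i j x)" for j
    by (intro bounded_integrable_integrable bounded_integrable_mult bounded_integrable_indicator
        shifted_trawl_finite)
  have "(\<integral>x. ?i k x * trawl_increment a d (k + l) x \<partial>lborel)
      = (\<integral>x. ?i k x * ?i (k + l + 1) x \<partial>lborel) - (\<integral>x. ?i k x * ?i (k + l) x \<partial>lborel)"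
    unfolding trawl_increment_def right_diff_distrib
    by (rule Bochner_Integration.integral_diff) (rule int)+
  also have "\<dots> = tail_area a (real (l + 1) * d) - tail_area a (real l * d)"
    unfolding integral_indicator_shifted_trawl using assms by (simp add: algebra_simps abs_mult)
  finally show ?thesis .
qed

text \<open>The difference quotient is an average of \<open>a\<close> over \<open>[h, h + d]\<close> and so lies between the values of \<open>a\<close> at the end points.\<close>

lemma tail_area_slope_tendsto:
  assumes "h \<longlonglongrightarrow> t" "d \<longlonglongrightarrow> 0" and pos: "\<forall>\<^sub>F n in sequentially. 0 \<le> h n \<and> 0 < d n" and "0 \<le> t"
  shows "(\<lambda>n. (tail_area a (h n) - tail_area a (h n + d n)) / d n) \<longlonglongrightarrow> a t"
proof -
  have cont: "(\<lambda>n. a (g n)) \<longlonglongrightarrow> a t" if "g \<longlonglongrightarrow> t" "\<forall>\<^sub>F n in sequentially. 0 \<le> g n" for g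
    using trawl_continuous that \<open>0 \<le> t\<close>
    by (intro continuous_on_tendsto_compose[OF trawl_continuous]) (auto elim: eventually_mono)
  show ?thesis
  proof (rule tendsto_sandwich)
    show "(\<lambda>n. a (h n + d n)) \<longlonglongrightarrow> a t"
      using tendsto_add[OF assms(1,2)] pos by (intro cont) (auto elim!: eventually_mono)
    show "(\<lambda>n. a (h n)) \<longlonglongrightarrow> a t"
      using assms(1) pos by (intro cont) (auto elim: eventually_mono)
    show "\<forall>\<^sub>F n in sequentially. a (h n + d n) \<le> (tail_area a (h n) - tail_area a (h n + d n)) / d n"
      using pos 
    proof eventually_elim
      case (elim n)
      then show ?case using tail_area_diff_bounds(1)[of "h n" "h n + d n"]
        by (simp add: pos_le_divide_eq mult.commute)
    qed
    show "\<forall>\<^sub>F n in sequentially. (tail_area a (h n) - tail_area a (h n + d n)) / d n \<le> a (h n)"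
      using pos 
    proof eventually_elim
      case (elim n)
      then show ?case using tail_area_diff_bounds(2)[of "h n" "h n + d n"]
        by (simp add: pos_divide_le_eq mult.commute)
    qed
  qed
qed

end

section \<open>A criterion for convergence in probability\<close>

lemma (in prob_space) expectation_abs_le_sqrt:
  fixes W :: "'a \<Rightarrow> real"
  assumes [measurable]: "random_variable borel W" and sq: "integrable M (\<lambda>\<omega>. (W \<omega>)\<^sup>2)"
  shows "expectation (\<lambda>\<omega>. \<bar>W \<omega>\<bar>) \<le> sqrt (expectation (\<lambda>\<omega>. (W \<omega>)\<^sup>2))"
proof -
  have "integrable M W" by (rule square_integrable_imp_integrable) (use sq in auto)
  then have "variance (\<lambda>\<omega>. \<bar>W \<omega>\<bar>) = expectation (\<lambda>\<omega>. (W \<omega>)\<^sup>2) - (expectation (\<lambda>\<omega>. \<bar>W \<omega>\<bar>))\<^sup>2"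
    using sq by (subst variance_eq) auto
  moreover have "variance (\<lambda>\<omega>. \<bar>W \<omega>\<bar>) \<ge> 0" by (rule variance_positive)
  ultimately show ?thesis by (intro real_le_rsqrt) simp
qed

text \<open>The main term \<open>S\<close> is close to the numbers \<open>s\<close> in \<open>L\<^sup>2\<close> and the remainder \<open>R\<close> is small in \<open>L\<^sup>1\<close>; both
  distances add up in \<open>L\<^sup>1\<close>, and Markov's inequality applies.\<close>

lemma (in prob_space) converges_in_probability_split:
  fixes Z S R :: "nat \<Rightarrow> 'a \<Rightarrow> real"
  assumes Z: "\<And>n. random_variable borel (Z n)"
    and split: "\<forall>\<^sub>F n in sequentially. (\<forall>\<omega>. Z n \<omega> = S n \<omega> + R n \<omega>)
      \<and> random_variable borel (S n) \<and> integrable M (\<lambda>\<omega>. (S n \<omega> - s n)\<^sup>2)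
      \<and> expectation (\<lambda>\<omega>. (S n \<omega> - s n)\<^sup>2) \<le> v n
      \<and> integrable M (R n) \<and> expectation (\<lambda>\<omega>. \<bar>R n \<omega>\<bar>) \<le> r n"
    and lim: "v \<longlonglongrightarrow> 0" "r \<longlonglongrightarrow> 0" "s \<longlonglongrightarrow> c"
  shows "converges_in_probability M Z c"
  unfolding converges_in_probability_def
proof (intro conjI allI impI)
  fix \<epsilon> :: real assume \<epsilon>: "\<epsilon> > 0"
  define e where "e n = (sqrt (v n) + \<bar>s n - c\<bar> + r n) / \<epsilon>" for n
  have "e \<longlonglongrightarrow> (sqrt 0 + \<bar>c - c\<bar> + 0) / \<epsilon>"
    unfolding e_def using \<epsilon> by (intro tendsto_intros lim) auto
  then have e: "e \<longlonglongrightarrow> 0" by simp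
  have "\<forall>\<^sub>F n in sequentially. measure M {\<omega> \<in> space M. \<bar>Z n \<omega> - c\<bar> > \<epsilon>} \<le> e n"
    using split
  proof eventually_elim
    case (elim n)
    then have Z_eq: "\<And>\<omega>. Z n \<omega> = S n \<omega> + R n \<omega>" and [measurable]: "random_variable borel (S n)"
      and sq: "integrable M (\<lambda>\<omega>. (S n \<omega> - s n)\<^sup>2)" and v: "expectation (\<lambda>\<omega>. (S n \<omega> - s n)\<^sup>2) \<le> v n"
      and R: "integrable M (R n)" and r: "expectation (\<lambda>\<omega>. \<bar>R n \<omega>\<bar>) \<le> r n"
      by auto
    have "integrable M (\<lambda>\<omega>. S n \<omega> - s n)" by (rule square_integrable_imp_integrable) (use sq in auto)
    then have S: "integrable M (\<lambda>\<omega>. \<bar>S n \<omega> - s n\<bar>)" by simp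
    have bound: "integrable M (\<lambda>\<omega>. \<bar>S n \<omega> - s n\<bar> + \<bar>s n - c\<bar> + \<bar>R n \<omega>\<bar>)"
      using S R by simp
    have Z_le: "\<bar>Z n \<omega> - c\<bar> \<le> \<bar>S n \<omega> - s n\<bar> + \<bar>s n - c\<bar> + \<bar>R n \<omega>\<bar>" for \<omega>
      unfolding Z_eq by linarith
    have int: "integrable M (\<lambda>\<omega>. \<bar>Z n \<omega> - c\<bar>)"
      by (rule Bochner_Integration.integrable_bound[OF bound]) (use Z Z_le in auto)
    have "measure M {\<omega> \<in> space M. \<bar>Z n \<omega> - c\<bar> > \<epsilon>} \<le> measure M {\<omega> \<in> space M. \<epsilon> \<le> \<bar>Z n \<omega> - c\<bar>}"
      using Z by (intro finite_measure_mono) auto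
    also have "\<dots> \<le> expectation (\<lambda>\<omega>. \<bar>Z n \<omega> - c\<bar>) / \<epsilon>"
      using \<epsilon> int by (intro integral_Markov_inequality_measure[where A = "{}"]) auto
    also have "expectation (\<lambda>\<omega>. \<bar>Z n \<omega> - c\<bar>)
        \<le> expectation (\<lambda>\<omega>. \<bar>S n \<omega> - s n\<bar> + \<bar>s n - c\<bar> + \<bar>R n \<omega>\<bar>)"
      by (intro integral_mono int bound Z_le)
    also have "\<dots> = expectation (\<lambda>\<omega>. \<bar>S n \<omega> - s n\<bar>) + \<bar>s n - c\<bar> + expectation (\<lambda>\<omega>. \<bar>R n \<omega>\<bar>)"
      using S R by (simp add: prob_space)
    also have "\<dots> \<le> sqrt (v n) + \<bar>s n - c\<bar> + r n"
    proof -
      have "expectation (\<lambda>\<omega>. \<bar>S n \<omega> - s n\<bar>) \<le> sqrt (expectation (\<lambda>\<omega>. (S n \<omega> - s n)\<^sup>2))"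
        using sq by (intro expectation_abs_le_sqrt) auto
      also have "\<dots> \<le> sqrt (v n)" using v by simp
      finally show ?thesis using r by simp
    qed
    finally show ?case using \<epsilon> by (simp add: e_def divide_right_mono)
  qed
  then show "(\<lambda>n. measure M {\<omega> \<in> space M. \<bar>Z n \<omega> - c\<bar> > \<epsilon>}) \<longlonglongrightarrow> 0"
    by (intro tendsto_sandwich[OF _ _ tendsto_const e]) auto
qed (rule Z)

section \<open>Decomposition of the estimator\<close>

text \<open>With \<open>c\<close> the mean of the trawl process, this allows the estimator to be computed from the centred path.\<close>

lemma sample_mean_shift:
  assumes "n > 0"
  shows "sample_mean f d n = (\<Sum>k<n. f (real k * d) - c) / n + c"
proof -
  have "(\<Sum>k=1..n. f ((real k - 1) * d)) = (\<Sum>k<n. f (real k * d))"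
    by (rule sum.reindex_bij_witness[of _ Suc "\<lambda>k. k - 1"]) (auto simp: of_nat_diff)
  then show ?thesis
    using assms by (simp add: sample_mean_def sum_subtractf field_simps)
qed

text \<open>Subtracting consecutive sample autocovariances gives a sum of products of values and increments. The sample
  mean \<open>\<mu>\<close> multiplies a telescoping sum, and the longer of the two sums contributes one more product.\<close>

lemma trawl_estimator_decomposition:
  fixes f :: "real \<Rightarrow> real" and c d :: real
  assumes "t \<noteq> 0" and n: "n = m + lag d t + 1"
  defines "l \<equiv> lag d t" and "g \<equiv> (\<lambda>k. f (real k * d) - c)"
  defines "\<mu> \<equiv> (\<Sum>k<n. g k) / n"
  shows "trawl_estimator f d n t = - (1 / (real n * d)) * (\<Sum>k<m. g k * (g (k + l + 1) - g (k + l)))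
    + 1 / (real n * d) * (\<mu> * (g (n - 1) - g l) + (g (n - 1) - \<mu>) * (g m - \<mu>))"
proof -
  have nl: "n = m + l + 1" using n by (simp add: l_def)
  have "sample_mean f d n = \<mu> + c" using sample_mean_shift[of n f d c] nl by (simp add: \<mu>_def g_def)
  then have cov: "sample_autocov f d n j = (1 / n) * (\<Sum>k<n - j. (g (k + j) - \<mu>) * (g k - \<mu>))" for j
    by (simp add: sample_autocov_def g_def diff_diff_eq add.commute)
  have "(\<Sum>k<n - l. (g (k + l) - \<mu>) * (g k - \<mu>))
      = (\<Sum>k<m. (g (k + l) - \<mu>) * (g k - \<mu>)) + (g (n - 1) - \<mu>) * (g m - \<mu>)"
    using nl by simp
  moreover have "(\<Sum>k<n - (l + 1). (g (k + (l + 1)) - \<mu>) * (g k - \<mu>)) - (\<Sum>k<m. (g (k + l) - \<mu>) * (g k - \<mu>))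
      = (\<Sum>k<m. g k * (g (k + l + 1) - g (k + l))) - \<mu> * (g (n - 1) - g l)"
  proof -
    have tele: "(\<Sum>k<m. g (k + l + 1) - g (k + l)) = g (n - 1) - g l"
      using sum_lessThan_telescope[of "\<lambda>k. g (k + l)" m] nl by simp
    have "(\<Sum>k<n - (l + 1). (g (k + (l + 1)) - \<mu>) * (g k - \<mu>)) - (\<Sum>k<m. (g (k + l) - \<mu>) * (g k - \<mu>))
      = (\<Sum>k<m. g k * (g (k + l + 1) - g (k + l)) - \<mu> * (g (k + l + 1) - g (k + l)))"
      using nl by (simp add: sum_subtractf[symmetric] algebra_simps del: sum_subtractf)
    also have "\<dots> = (\<Sum>k<m. g k * (g (k + l + 1) - g (k + l))) - \<mu> * (g (n - 1) - g l)"
      by (subst sum_subtractf) (simp only: sum_distrib_left[symmetric] tele)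
    finally show ?thesis .
  qed
  ultimately have "(\<Sum>k<n - (l + 1). (g (k + (l + 1)) - \<mu>) * (g k - \<mu>)) - (\<Sum>k<n - l. (g (k + l) - \<mu>) * (g k - \<mu>))
      = (\<Sum>k<m. g k * (g (k + l + 1) - g (k + l))) - \<mu> * (g (n - 1) - g l) - (g (n - 1) - \<mu>) * (g m - \<mu>)"
    by linarith
  then have "sample_autocov f d n (l + 1) - sample_autocov f d n l = (1 / n) *
     ((\<Sum>k<m. g k * (g (k + l + 1) - g (k + l))) - \<mu> * (g (n - 1) - g l) - (g (n - 1) - \<mu>) * (g m - \<mu>))"
    unfolding cov right_diff_distrib[symmetric] by simp
  then show ?thesis
    using \<open>t \<noteq> 0\<close> by (simp add: trawl_estimator_def l_def[symmetric] diff_divide_distrib add_divide_distrib)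
qed

lemma boundary_term_le:
  fixes \<mu> p q r :: real
  shows "\<bar>\<mu> * (p - r) + (p - \<mu>) * (q - \<mu>)\<bar> \<le> 3 * (\<mu>\<^sup>2 + p\<^sup>2 + q\<^sup>2 + r\<^sup>2)"
proof -
  have "\<bar>x * y\<bar> \<le> (x\<^sup>2 + y\<^sup>2) / 2" for x y :: real
    using sum_squares_bound[of "\<bar>x\<bar>" "\<bar>y\<bar>"] by (simp add: abs_mult)
  from this[of \<mu> "p - r"] this[of "p - \<mu>" "q - \<mu>"]
  have "\<bar>\<mu> * (p - r) + (p - \<mu>) * (q - \<mu>)\<bar> \<le> (\<mu>\<^sup>2 + (p - r)\<^sup>2) / 2 + ((p - \<mu>)\<^sup>2 + (q - \<mu>)\<^sup>2) / 2"
    by linarith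
  moreover have "(x - y)\<^sup>2 \<le> 2 * x\<^sup>2 + 2 * y\<^sup>2" for x y :: real
    using sum_squares_bound[of x "- y"] by (simp add: power2_diff)
  from this[of p r] this[of p \<mu>] this[of q \<mu>]
  have "(\<mu>\<^sup>2 + (p - r)\<^sup>2) / 2 + ((p - \<mu>)\<^sup>2 + (q - \<mu>)\<^sup>2) / 2 \<le> 3 * (\<mu>\<^sup>2 + p\<^sup>2 + q\<^sup>2 + r\<^sup>2)"
    using zero_le_power2[of p] zero_le_power2[of q] zero_le_power2[of r] zero_le_power2[of \<mu>] by argo
  ultimately show ?thesis by linarith
qed

section \<open>Consistency\<close>

context standardized_levy_basis
begin

context
  fixes a :: "real \<Rightarrow> real"
  assumes a: "trawl_function a"
begin

definition centred_trawl :: "real \<Rightarrow> 'a \<Rightarrow> real" where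
  "centred_trawl s = Y (shifted_trawl a s)"

lemma trawl_process_eq_centred:
  "trawl_process L a s \<omega> = centred_trawl s \<omega> + expectation (L (shifted_trawl a 0))"
proof -
  have "measure lborel (shifted_trawl a s) = measure lborel (shifted_trawl a 0)"
    using measure_shifted_trawl_Int[OF a, of s s] measure_shifted_trawl_Int[OF a, of 0 0] by simp
  then have "expectation (L (shifted_trawl a s)) = expectation (L (shifted_trawl a 0))"
    using expectation_L_eq[of "shifted_trawl a s" "shifted_trawl a 0" "\<lambda>x. x"] shifted_trawl_finite[OF a] by simp
  then show ?thesis
    by (simp add: centred_trawl_def Y_def trawl_process_def shifted_trawl_eq_translate)
qed

lemma centred_trawl_fourth_power_integrable: "centred_trawl s \<in> fourth_power_integrable M"
  unfolding centred_trawl_def by (intro Y_fourth_power_integrable shifted_trawl_finite a)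

lemma centred_trawl_measurable [measurable]: "centred_trawl s \<in> borel_measurable M"
  by (rule fourth_power_integrable_measurable[OF centred_trawl_fourth_power_integrable])

lemma centred_trawl_square:
  "integrable M (\<lambda>\<omega>. (centred_trawl s \<omega>)\<^sup>2)" "expectation (\<lambda>\<omega>. (centred_trawl s \<omega>)\<^sup>2) = tail_area a 0"
proof -
  show "integrable M (\<lambda>\<omega>. (centred_trawl s \<omega>)\<^sup>2)"
    using integrable_mult2[OF centred_trawl_fourth_power_integrable centred_trawl_fourth_power_integrable]
    by (simp add: power2_eq_square)
  show "expectation (\<lambda>\<omega>. (centred_trawl s \<omega>)\<^sup>2) = tail_area a 0"
    unfolding centred_trawl_def
    using expectation_Y_square[OF shifted_trawl_finite[OF a], of s] measure_shifted_trawl_Int[OF a, of s s] by simp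
qed

lemma simple_integral_centred_trawl: "simple_integral (indicator (shifted_trawl a s)) (centred_trawl s)"
  unfolding centred_trawl_def by (rule simple_integral.indicator[OF shifted_trawl_finite[OF a]])

lemma simple_integral_trawl_increment:
  "simple_integral (trawl_increment a d k)
    (\<lambda>\<omega>. centred_trawl (real (k + 1) * d) \<omega> - centred_trawl (real k * d) \<omega>)"
  unfolding trawl_increment_def[abs_def] by (intro simple_integral.diff simple_integral_centred_trawl)

lemma trawl_estimator_measurable:
  "random_variable borel (\<lambda>\<omega>. trawl_estimator (\<lambda>s. trawl_process L a s \<omega>) d n t)"
  unfolding trawl_estimator_def sample_autocov_def sample_mean_def trawl_process_eq_centred by measurable

text \<open>\<open>\<mu>\<close> is the sample mean; its second moment is at most the average of the second moments, \<open>tail_area a 0\<close>.\<close>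

lemma expectation_boundary_term_le:
  fixes i :: "nat \<Rightarrow> real" and p q r :: real
  assumes "n > 0"
  defines "\<mu> \<equiv> (\<lambda>\<omega>. (\<Sum>k<n. centred_trawl (i k) \<omega>) / n)"
  defines "R \<equiv> (\<lambda>\<omega>. \<mu> \<omega> * (centred_trawl p \<omega> - centred_trawl r \<omega>)
      + (centred_trawl p \<omega> - \<mu> \<omega>) * (centred_trawl q \<omega> - \<mu> \<omega>))"
  shows "integrable M R" "expectation (\<lambda>\<omega>. \<bar>R \<omega>\<bar>) \<le> 12 * tail_area a 0"
proof -
  define B where "B \<omega> = 3 * ((\<Sum>k<n. (centred_trawl (i k) \<omega>)\<^sup>2) / n + (centred_trawl p \<omega>)\<^sup>2
      + (centred_trawl q \<omega>)\<^sup>2 + (centred_trawl r \<omega>)\<^sup>2)" for \<omega>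
  have R_le: "\<bar>R \<omega>\<bar> \<le> B \<omega>" for \<omega>
  proof -
    have "(\<Sum>k<n. centred_trawl (i k) \<omega>)\<^sup>2 \<le> (\<Sum>k<n. (centred_trawl (i k) \<omega>)\<^sup>2) * n"
      using sum_squared_le_sum_of_squares[of "\<lambda>k. centred_trawl (i k) \<omega>" "{..<n}"] by simp
    then have "(\<mu> \<omega>)\<^sup>2 \<le> (\<Sum>k<n. (centred_trawl (i k) \<omega>)\<^sup>2) / n"
      using assms(1) by (simp add: \<mu>_def power_divide divide_simps power2_eq_square mult.assoc[symmetric])
    then have "3 * ((\<mu> \<omega>)\<^sup>2 + (centred_trawl p \<omega>)\<^sup>2 + (centred_trawl q \<omega>)\<^sup>2 + (centred_trawl r \<omega>)\<^sup>2) \<le> B \<omega>"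
      unfolding B_def by (intro mult_left_mono add_right_mono) auto
    then show ?thesis unfolding R_def by (rule order_trans[OF boundary_term_le])
  qed
  have B: "integrable M B" unfolding B_def by (intro integrable_mult_right Bochner_Integration.integrable_add
      integrable_divide Bochner_Integration.integrable_sum centred_trawl_square)
  have R[measurable]: "R \<in> borel_measurable M" unfolding R_def \<mu>_def by measurable
  have B_nonneg: "B \<omega> \<ge> 0" for \<omega> using R_le[of \<omega>] by linarith
  show R_int: "integrable M R"
    by (rule Bochner_Integration.integrable_bound[OF B R]) (use R_le B_nonneg in \<open>auto intro!: AE_I2\<close>)
  have "expectation (\<lambda>\<omega>. \<bar>R \<omega>\<bar>) \<le> expectation B"
    by (intro integral_mono R_le B integrable_abs R_int)
  also have "\<dots> = 12 * tail_area a 0"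
    unfolding B_def using centred_trawl_square assms(1) by simp
  finally show "expectation (\<lambda>\<omega>. \<bar>R \<omega>\<bar>) \<le> 12 * tail_area a 0" .
qed

text \<open>The variance bound in the form shared by \<open>t = 0\<close> and \<open>t > 0\<close>, with \<open>w\<close> the normalising factor. The bound
  \<open>2 * tail_area a 0\<close> on \<open>\<integral> |u k|\<close> covers both indicators and increments of trawl sets.\<close>

lemma scaled_variance_le:
  fixes u :: "nat \<Rightarrow> real \<times> real \<Rightarrow> real" and U V :: "nat \<Rightarrow> 'a \<Rightarrow> real"
  assumes d: "d > 0" and n: "n > 0" "m \<le> n" and w: "\<bar>w\<bar> \<le> 1 / (real n * d)"
    and u: "\<And>k. simple_integral (u k) (U k)" "\<And>k x. \<bar>u k x\<bar> \<le> 1"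
      "\<And>k. (\<integral>x. \<bar>u k x\<bar> \<partial>lborel) \<le> 2 * tail_area a 0"
    and c: "\<And>k. (\<integral>x. u k x * trawl_increment a d (k + l) x \<partial>lborel) = c"
  defines "V \<equiv> (\<lambda>k \<omega>. centred_trawl (real (k + l + 1) * d) \<omega> - centred_trawl (real (k + l) * d) \<omega>)"
  shows "random_variable borel (\<lambda>\<omega>. w * (\<Sum>k<m. U k \<omega> * V k \<omega>))"
    and "integrable M (\<lambda>\<omega>. (w * (\<Sum>k<m. U k \<omega> * V k \<omega>) - w * (real m * c))\<^sup>2)"
    and "expectation (\<lambda>\<omega>. (w * (\<Sum>k<m. U k \<omega> * V k \<omega>) - w * (real m * c))\<^sup>2)
      \<le> 4 * a 0 * (\<kappa> + 4 * tail_area a 0) / (real n * d)"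
proof -
  have V: "simple_integral (trawl_increment a d (k + l)) (V k)" for k
    using simple_integral_trawl_increment[of d "k + l"] by (simp add: V_def)
  have [measurable]: "U k \<in> borel_measurable M" "V k \<in> borel_measurable M" for k
    using u(1) V by (blast intro: fourth_power_integrable_measurable simple_integral_fourth_power_integrable)+
  show "random_variable borel (\<lambda>\<omega>. w * (\<Sum>k<m. U k \<omega> * V k \<omega>))" by measurable
  define Q where "Q \<omega> = ((\<Sum>k<m. U k \<omega> * V k \<omega>) - real m * c)\<^sup>2" for \<omega>
  have Q_w: "(w * (\<Sum>k<m. U k \<omega> * V k \<omega>) - w * (real m * c))\<^sup>2 = w\<^sup>2 * Q \<omega>" for \<omega>
    unfolding Q_def right_diff_distrib[symmetric] by (simp add: power_mult_distrib)
  have "integrable M Q" and E_Q: "expectation Q \<le> 2 * real m * (2 * d * a 0) * (\<kappa> + 2 * (2 * tail_area a 0))"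
    using variance_sum_products_le[where u = u and U = U and v = "\<lambda>k. trawl_increment a d (k + l)" and V = V
        and m = m and K = "2 * tail_area a 0" and \<eta> = "2 * d * a 0"]
      u V sum_abs_trawl_increment_le_2[OF a d] integral_abs_trawl_increment_le[OF a d]
    by (simp_all add: c Q_def[abs_def])
  then show "integrable M (\<lambda>\<omega>. (w * (\<Sum>k<m. U k \<omega> * V k \<omega>) - w * (real m * c))\<^sup>2)"
    unfolding Q_w by simp
  have nonneg: "a 0 \<ge> 0" "\<kappa> + 4 * tail_area a 0 \<ge> 0"
    using trawl_nonneg[OF a, of 0] \<kappa>_nonneg tail_area_nonneg[OF a, of 0] by auto
  have "w\<^sup>2 * expectation Q \<le> (1 / (real n * d))\<^sup>2 * (2 * real n * (2 * d * a 0) * (\<kappa> + 4 * tail_area a 0))"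
  proof (rule mult_mono)
    show "w\<^sup>2 \<le> (1 / (real n * d))\<^sup>2" using w abs_le_square_iff[of w "1 / (real n * d)"] d by simp
    have "2 * real m * (2 * d * a 0) * (\<kappa> + 4 * tail_area a 0) \<le> 2 * real n * (2 * d * a 0) * (\<kappa> + 4 * tail_area a 0)"
      using n d nonneg by (intro mult_right_mono mult_left_mono) auto
    then show "expectation Q \<le> 2 * real n * (2 * d * a 0) * (\<kappa> + 4 * tail_area a 0)" using E_Q by simp
  qed (auto simp: Q_def)
  also have "\<dots> = 4 * a 0 * (\<kappa> + 4 * tail_area a 0) / (real n * d)"
    using d n by (simp add: power2_eq_square)
  finally show "expectation (\<lambda>\<omega>. (w * (\<Sum>k<m. U k \<omega> * V k \<omega>) - w * (real m * c))\<^sup>2)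
      \<le> 4 * a 0 * (\<kappa> + 4 * tail_area a 0) / (real n * d)"
    unfolding Q_w by simp
qed

lemma integral_abs_indicator_trawl: "(\<integral>x. \<bar>indicator (shifted_trawl a s) x :: real\<bar> \<partial>lborel) \<le> 2 * tail_area a 0"
  using integral_indicator_finite_borel[OF shifted_trawl_finite[OF a], of s]
    measure_shifted_trawl_Int[OF a, of s s] tail_area_nonneg[OF a, of 0] by simp

text \<open>Here both factors of each product are increments, \<open>u k = v k\<close>, and there is no boundary term.\<close>

lemma trawl_estimator_consistent_at_0:
  fixes \<Delta> :: "nat \<Rightarrow> real"
  assumes \<Delta>_pos: "\<And>n. n \<ge> 1 \<Longrightarrow> \<Delta> n > 0" and \<Delta>_0: "\<Delta> \<longlonglongrightarrow> 0"
    and n\<Delta>: "filterlim (\<lambda>n. real n * \<Delta> n) at_top sequentially"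
  shows "converges_in_probability M (\<lambda>n \<omega>. trawl_estimator (\<lambda>s. trawl_process L a s \<omega>) (\<Delta> n) n 0) (a 0)"
proof -
  define D where "D n k \<omega> = centred_trawl (real (k + 1) * \<Delta> n) \<omega> - centred_trawl (real k * \<Delta> n) \<omega>" for n k \<omega>
  define w where "w n = 1 / (2 * \<Delta> n * real n)" for n
  define c where "c n = 2 * (tail_area a 0 - tail_area a (\<Delta> n))" for n
  show ?thesis
  proof (rule converges_in_probability_split[where S = "\<lambda>n \<omega>. w n * (\<Sum>k<n - 1. D n k \<omega> * D n k \<omega>)"
        and R = "\<lambda>_ _. 0" and s = "\<lambda>n. w n * (real (n - 1) * c n)"
        and v = "\<lambda>n. 4 * a 0 * (\<kappa> + 4 * tail_area a 0) / (real n * \<Delta> n)" and r = "\<lambda>_. 0"])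
    show "\<forall>\<^sub>F n in sequentially.
      (\<forall>\<omega>. trawl_estimator (\<lambda>s. trawl_process L a s \<omega>) (\<Delta> n) n 0 = w n * (\<Sum>k<n - 1. D n k \<omega> * D n k \<omega>) + 0)
      \<and> random_variable borel (\<lambda>\<omega>. w n * (\<Sum>k<n - 1. D n k \<omega> * D n k \<omega>))
      \<and> integrable M (\<lambda>\<omega>. (w n * (\<Sum>k<n - 1. D n k \<omega> * D n k \<omega>) - w n * (real (n - 1) * c n))\<^sup>2)
      \<and> expectation (\<lambda>\<omega>. (w n * (\<Sum>k<n - 1. D n k \<omega> * D n k \<omega>) - w n * (real (n - 1) * c n))\<^sup>2)
          \<le> 4 * a 0 * (\<kappa> + 4 * tail_area a 0) / (real n * \<Delta> n)
      \<and> integrable M (\<lambda>_. 0 :: real) \<and> expectation (\<lambda>_. \<bar>0 :: real\<bar>) \<le> 0"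
      using eventually_ge_at_top[of 1]
    proof eventually_elim
      case (elim n)
      have d: "\<Delta> n > 0" and n: "n > 0" "n - 1 \<le> n" using \<Delta>_pos elim by auto
      have w: "\<bar>w n\<bar> \<le> 1 / (real n * \<Delta> n)" using d n by (simp add: w_def field_simps)
      have u: "simple_integral (trawl_increment a (\<Delta> n) k) (D n k)" for k
        using simple_integral_trawl_increment[of "\<Delta> n" k] by (simp add: D_def[abs_def])
      have abs_u: "(\<integral>x. \<bar>trawl_increment a (\<Delta> n) k x\<bar> \<partial>lborel) \<le> 2 * tail_area a 0" for k
        unfolding abs_trawl_increment integral_trawl_increment_square[OF a d]
        using tail_area_nonneg[OF a, of "\<Delta> n"] d by simp
      have c: "(\<integral>x. trawl_increment a (\<Delta> n) k x * trawl_increment a (\<Delta> n) (k + 0) x \<partial>lborel) = c n" for k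
        using integral_trawl_increment_square[OF a d, of k] by (simp add: c_def power2_eq_square)
      have "trawl_estimator (\<lambda>s. trawl_process L a s \<omega>) (\<Delta> n) n 0 = w n * (\<Sum>k<n - 1. D n k \<omega> * D n k \<omega>) + 0" for \<omega>
        by (simp add: trawl_estimator_def trawl_process_eq_centred D_def w_def power2_eq_square)
      then show ?case
        using scaled_variance_le[OF d n w u abs_trawl_increment_le_1 abs_u c]
        by (simp add: D_def)
    qed
    show "(\<lambda>n. 4 * a 0 * (\<kappa> + 4 * tail_area a 0) / (real n * \<Delta> n)) \<longlonglongrightarrow> 0"
      by (intro tendsto_divide_0[OF tendsto_const] filterlim_at_top_imp_at_infinity n\<Delta>)
    have "(\<lambda>n. (tail_area a 0 - tail_area a (0 + \<Delta> n)) / \<Delta> n) \<longlonglongrightarrow> a 0"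
      using \<Delta>_pos by (intro tail_area_slope_tendsto[OF a] \<Delta>_0 tendsto_const)
        (auto simp: eventually_sequentially)
    moreover have "(\<lambda>n. real (n - 1) / real n) \<longlonglongrightarrow> 1" by real_asymp
    ultimately have "(\<lambda>n. real (n - 1) / real n * ((tail_area a 0 - tail_area a (0 + \<Delta> n)) / \<Delta> n)) \<longlonglongrightarrow> 1 * a 0"
      by (intro tendsto_mult)
    moreover have "1 / (2 * d * n) * (m * (2 * x)) = m / n * (x / d)" for d n m x :: real
      by simp
    ultimately show "(\<lambda>n. w n * (real (n - 1) * c n)) \<longlonglongrightarrow> a 0"
      by (simp only: w_def c_def) simp
  qed (use trawl_estimator_measurable in auto)
qed

text \<open>Here \<open>u k\<close> is the indicator of the trawl set at time \<open>k * \<Delta> n\<close> and \<open>v k\<close> is the increment that starts \<open>l n\<close>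
  steps later, so the two overlap only in points that leave the trawl set during that step.\<close>

lemma trawl_estimator_consistent_at_pos:
  fixes \<Delta> :: "nat \<Rightarrow> real"
  assumes \<Delta>_pos: "\<And>n. n \<ge> 1 \<Longrightarrow> \<Delta> n > 0" and \<Delta>_0: "\<Delta> \<longlonglongrightarrow> 0"
    and n\<Delta>: "filterlim (\<lambda>n. real n * \<Delta> n) at_top sequentially" and t: "t > 0"
  shows "converges_in_probability M (\<lambda>n \<omega>. trawl_estimator (\<lambda>s. trawl_process L a s \<omega>) (\<Delta> n) n t) (a t)"
proof -
  define l where "l n = lag (\<Delta> n) t" for n
  define m where "m n = n - (l n + 1)" for n
  define g where "g n k \<omega> = centred_trawl (real k * \<Delta> n) \<omega>" for n k \<omega>
  define \<mu> where "\<mu> n \<omega> = (\<Sum>k<n. g n k \<omega>) / real n" for n \<omega>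
  define R where "R n \<omega> = \<mu> n \<omega> * (g n (n - 1) \<omega> - g n (l n) \<omega>)
      + (g n (n - 1) \<omega> - \<mu> n \<omega>) * (g n (m n) \<omega> - \<mu> n \<omega>)" for n \<omega>
  define w where "w n = - (1 / (real n * \<Delta> n))" for n
  define V where "V n k \<omega> = g n (k + l n + 1) \<omega> - g n (k + l n) \<omega>" for n k \<omega>
  define c where "c n = tail_area a (real (l n + 1) * \<Delta> n) - tail_area a (real (l n) * \<Delta> n)" for n
  have lag: "\<Delta> n * real (l n) \<le> t" "t < (real (l n) + 1) * \<Delta> n" if "n \<ge> 1" for n
    using lag_iff[OF \<Delta>_pos[OF that], of t "l n"] t by (auto simp: l_def)
  have ev: "\<forall>\<^sub>F n in sequentially. n \<ge> 1 \<and> l n < n"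
    using filterlim_at_top_dense[THEN iffD1, OF n\<Delta>, rule_format, of t] eventually_ge_at_top[of 1]
  proof eventually_elim
    case (elim n)
    have "\<Delta> n * real (l n) < \<Delta> n * real n" using lag(1)[OF elim(2)] elim(1) by (simp add: mult.commute)
    then show ?case using \<Delta>_pos[OF elim(2)] elim(2) by simp
  qed
  show ?thesis
  proof (rule converges_in_probability_split[where S = "\<lambda>n \<omega>. w n * (\<Sum>k<m n. g n k \<omega> * V n k \<omega>)"
        and R = "\<lambda>n \<omega>. 1 / (real n * \<Delta> n) * R n \<omega>" and s = "\<lambda>n. w n * (real (m n) * c n)"
        and v = "\<lambda>n. 4 * a 0 * (\<kappa> + 4 * tail_area a 0) / (real n * \<Delta> n)"
        and r = "\<lambda>n. 12 * tail_area a 0 / (real n * \<Delta> n)"])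
    show "\<forall>\<^sub>F n in sequentially.
      (\<forall>\<omega>. trawl_estimator (\<lambda>s. trawl_process L a s \<omega>) (\<Delta> n) n t
        = w n * (\<Sum>k<m n. g n k \<omega> * V n k \<omega>) + 1 / (real n * \<Delta> n) * R n \<omega>)
      \<and> random_variable borel (\<lambda>\<omega>. w n * (\<Sum>k<m n. g n k \<omega> * V n k \<omega>))
      \<and> integrable M (\<lambda>\<omega>. (w n * (\<Sum>k<m n. g n k \<omega> * V n k \<omega>) - w n * (real (m n) * c n))\<^sup>2)
      \<and> expectation (\<lambda>\<omega>. (w n * (\<Sum>k<m n. g n k \<omega> * V n k \<omega>) - w n * (real (m n) * c n))\<^sup>2)
          \<le> 4 * a 0 * (\<kappa> + 4 * tail_area a 0) / (real n * \<Delta> n)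
      \<and> integrable M (\<lambda>\<omega>. 1 / (real n * \<Delta> n) * R n \<omega>)
      \<and> expectation (\<lambda>\<omega>. \<bar>1 / (real n * \<Delta> n) * R n \<omega>\<bar>) \<le> 12 * tail_area a 0 / (real n * \<Delta> n)"
      using ev
    proof eventually_elim
      case (elim n)
      have d: "\<Delta> n > 0" and n: "n > 0" "m n \<le> n" using \<Delta>_pos elim by (auto simp: m_def)
      have w: "\<bar>w n\<bar> \<le> 1 / (real n * \<Delta> n)" using d n by (simp add: w_def)
      have nm: "n = m n + lag (\<Delta> n) t + 1" using elim by (simp add: m_def l_def)
      have decomp: "trawl_estimator (\<lambda>s. trawl_process L a s \<omega>) (\<Delta> n) n t
        = w n * (\<Sum>k<m n. g n k \<omega> * V n k \<omega>) + 1 / (real n * \<Delta> n) * R n \<omega>" for \<omega>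
        using trawl_estimator_decomposition[OF _ nm, of "\<lambda>s. trawl_process L a s \<omega>" "expectation (L (shifted_trawl a 0))"] t
        by (simp add: trawl_process_eq_centred w_def V_def g_def R_def \<mu>_def l_def)
      have R: "integrable M (R n)" "expectation (\<lambda>\<omega>. \<bar>R n \<omega>\<bar>) \<le> 12 * tail_area a 0"
        using expectation_boundary_term_le[OF n(1), of "\<lambda>k. real k * \<Delta> n" "real (n - 1) * \<Delta> n" "real (l n) * \<Delta> n" "real (m n) * \<Delta> n"]
        by (simp_all add: R_def[abs_def] g_def \<mu>_def)
      have R': "expectation (\<lambda>\<omega>. \<bar>1 / (real n * \<Delta> n) * R n \<omega>\<bar>) \<le> 12 * tail_area a 0 / (real n * \<Delta> n)"
        using R(2) d n by (simp add: abs_mult divide_right_mono)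
      note S = scaled_variance_le[OF d n w simple_integral_centred_trawl _ integral_abs_indicator_trawl
          integral_trawl_times_increment[OF a d]]
      show ?case
        using decomp R(1) R' S[of "l n"]
        by (simp add: g_def V_def c_def indicator_def)
    qed
    show "(\<lambda>n. 4 * a 0 * (\<kappa> + 4 * tail_area a 0) / (real n * \<Delta> n)) \<longlonglongrightarrow> 0"
      "(\<lambda>n. 12 * tail_area a 0 / (real n * \<Delta> n)) \<longlonglongrightarrow> 0"
      by (intro tendsto_divide_0[OF tendsto_const] filterlim_at_top_imp_at_infinity n\<Delta>)+
    \<comment> \<open>The number \<open>m n\<close> of summands is \<open>n - l n - 1\<close>, and \<open>l n / n \<longlonglongrightarrow> 0\<close> because \<open>l n * \<Delta> n\<close> stays bounded.\<close>
    have h: "(\<lambda>n. real (l n) * \<Delta> n) \<longlonglongrightarrow> t"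
    proof (rule tendsto_sandwich)
      show "\<forall>\<^sub>F n in sequentially. t - \<Delta> n \<le> real (l n) * \<Delta> n"
        using eventually_ge_at_top[of 1] by eventually_elim (use lag(2) in \<open>force simp: algebra_simps\<close>)
      show "\<forall>\<^sub>F n in sequentially. real (l n) * \<Delta> n \<le> t"
        using eventually_ge_at_top[of 1] by eventually_elim (use lag(1) in \<open>force simp: algebra_simps\<close>)
      show "(\<lambda>n. t - \<Delta> n) \<longlonglongrightarrow> t" using tendsto_diff[OF tendsto_const \<Delta>_0, of t] by simp
    qed simp
    have slope: "(\<lambda>n. (tail_area a (real (l n) * \<Delta> n) - tail_area a (real (l n) * \<Delta> n + \<Delta> n)) / \<Delta> n) \<longlonglongrightarrow> a t"
    proof (rule tail_area_slope_tendsto[OF a h \<Delta>_0])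
      show "\<forall>\<^sub>F n in sequentially. 0 \<le> real (l n) * \<Delta> n \<and> 0 < \<Delta> n"
        using eventually_ge_at_top[of 1]
      proof eventually_elim
        case (elim n)
        then show ?case using \<Delta>_pos[of n] by simp
      qed
    qed (use t in simp)
    have "(\<lambda>n. (real (l n) * \<Delta> n) / (real n * \<Delta> n)) \<longlonglongrightarrow> 0"
      by (rule tendsto_divide_0[OF h]) (rule filterlim_at_top_imp_at_infinity[OF n\<Delta>])
    moreover have "(\<lambda>n. 1 / real n) \<longlonglongrightarrow> 0" by real_asymp
    ultimately have "(\<lambda>n. 1 - (real (l n) * \<Delta> n) / (real n * \<Delta> n) - 1 / real n) \<longlonglongrightarrow> 1 - 0 - 0"
      by (intro tendsto_intros)
    from tendsto_mult[OF this slope]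
    have "(\<lambda>n. (1 - (real (l n) * \<Delta> n) / (real n * \<Delta> n) - 1 / real n)
        * ((tail_area a (real (l n) * \<Delta> n) - tail_area a (real (l n) * \<Delta> n + \<Delta> n)) / \<Delta> n)) \<longlonglongrightarrow> a t"
      by simp
    then show "(\<lambda>n. w n * (real (m n) * c n)) \<longlonglongrightarrow> a t"
    proof (rule Lim_transform_eventually)
      show "\<forall>\<^sub>F n in sequentially. (1 - (real (l n) * \<Delta> n) / (real n * \<Delta> n) - 1 / real n)
        * ((tail_area a (real (l n) * \<Delta> n) - tail_area a (real (l n) * \<Delta> n + \<Delta> n)) / \<Delta> n)
        = w n * (real (m n) * c n)"
        using ev
      proof eventually_elim
        case (elim n)
        have d: "\<Delta> n > 0" using \<Delta>_pos elim by auto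
        have m: "real (m n) = real n - real (l n) - 1" using elim by (simp add: m_def of_nat_diff)
        have c: "c n = - (tail_area a (real (l n) * \<Delta> n) - tail_area a (real (l n) * \<Delta> n + \<Delta> n))"
          by (simp add: c_def algebra_simps)
        show ?case unfolding m c w_def using d elim by (simp add: field_simps)
      qed
    qed
  qed (use trawl_estimator_measurable in auto)
qed

end

end

theorem theorem1:
  fixes M :: "'a measure"
    and L :: "(real \<times> real) set \<Rightarrow> 'a \<Rightarrow> real"
    and N :: "'b measure"
    and L' :: "'b \<Rightarrow> real"
    and \<gamma> b :: real
    and \<nu> :: "real measure"
    and a :: "real \<Rightarrow> real"
    and X :: "real \<Rightarrow> 'a \<Rightarrow> real"
    and \<Delta> :: "nat \<Rightarrow> real"
    and t :: real
  assumes "homogeneous_levy_basis M L \<gamma> b \<nu>"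
    and "levy_seed N L' \<gamma> b \<nu>"
    and "trawl_function a"
    and "X = trawl_process L a"
    and "\<And>n. n \<ge> 1 \<Longrightarrow> \<Delta> n > 0"
    and "\<Delta> \<longlonglongrightarrow> 0"
    and "filterlim (\<lambda>n. real n * \<Delta> n) at_top sequentially"
    and "prob_space.variance N L' = 1"
    and "integrable N (\<lambda>\<omega>. \<bar>L' \<omega>\<bar> ^ 4)"
    and "t \<ge> 0"
  shows "converges_in_probability M
           (\<lambda>n \<omega>. trawl_estimator (\<lambda>s. X s \<omega>) (\<Delta> n) n t) (a t)"
proof -
  interpret homogeneous_levy_basis M L \<gamma> b \<nu> by fact
  interpret standardized_levy_basis M L \<gamma> b \<nu> N L'
    by unfold_locales (fact assms)+
  show ?thesis
  proof (cases "t = 0")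
    case True
    then show ?thesis
      using trawl_estimator_consistent_at_0[OF assms(3,5,6,7)] by (simp add: assms(4))
  next
    case False
    then show ?thesis
      using trawl_estimator_consistent_at_pos[OF assms(3,5,6,7)] assms(10) by (simp add: assms(4))
  qed
qed

end
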